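(* Let $\mathcal{H}_A,\mathcal{H}_B$ be finite-dimensional Hilbert spaces, and let $\mathcal{M}_A$, $\mathcal{M}_B$ be measurements on $\mathcal{H}_A$, $\mathcal{H}_B$ with finite outcome alphabets $\mathcal{Y}$, $\mathcal{Z}$. (1) (Double extensions) Let $\rho_{A_1^nB_1^n}\in\mathcal{S}(\mathcal{H}_A^{\otimes n}\otimes\mathcal{H}_B^{\otimes n})$ be permutation invariant over the $A$-systems with respect to $B_1^n$ and over the $B$-systems with respect to $A_1^n$, and let $\omega_{Y_1^nZ_1^n}:=(\mathcal{M}_A^{\otimes n}\otimes\mathcal{M}_B^{\otimes n})(\rho_{A_1^nB_1^n})$. For $m_A,m_B\in\{0,\dots,n-1\}$ let $T_{m_A}$ and $T_{m_B}$ denote the type registers of $Y_2^{m_A+1}$ and $Z_2^{m_B+1}$. Then $$I(Y_1^n:Z_1^n)_\omega=\sum_{m_A=0}^{n-1}\sum_{m_B=0}^{n-1}I(Y_1:Z_1|T_{m_A}T_{m_B})_\omega.$$ (2) (One-sided extensions) Let $\rho_{AB_1^n}\in\mathcal{S}(\mathcal{H}_A\otimes\mathcal{H}_B^{\otimes n})$ be invariant under permutations of the $B$-systems and let $\omega_{AZ_1^n}:=(\mathrm{id}_A\otimes\mathcal{M}_B^{\otimes n})(\rho_{AB_1^n})$. For $m_B\in\{0,\dots,n-1\}$ let $T_{m_B}$ be the type register of $Z_2^{m_B+1}$. Then $$I(A:Z_1^n)_\omega=\sum_{m_B=0}^{n-1}I(A:Z_1|T_{m_B})_\omega.$$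
   Context: A measurement with POVM $\{M_z\}_{z\in\mathcal{Z}}$ is identified with the quantum-classical channel $\rho\mapsto\sum_z\mathrm{tr}[M_z\rho]|z\rangle\langle z|$. $S_n$ acts on $\mathcal{H}^{\otimes n}$ by permuting tensor factors; permutation invariance over the $B$-systems with respect to the other systems means invariance under conjugation by $1\otimes U_{B_1^n}(\sigma)$ for all $\sigma\in S_n$ (analogously for $A$). Notation $Z_k^m=Z_k\cdots Z_m$; for $m=0$ the register $Z_2^{m+1}$ is trivial. The type register $T_{m_B}$ is the classical register holding $\tau_B(Z_2^{m_B+1})$, where $\tau_B$ maps a string in $\mathcal{Z}^{m_B}$ to the vector in $\mathbb{N}_0^{\mathcal{Z}}$ counting how often each symbol occurs; $T_{m_A}$ likewise from $Y_2^{m_A+1}$. $I(A:B)=H(A)+H(B)-H(AB)$ and $I(A:B|C)=H(A|C)+H(B|C)-H(AB|C)$ with von Neumann entropies. *)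

theory Defs
  imports
    Complex_Main
    "HOL-Library.Countable_Set"
    "HOL-Library.Nonpos_Ints"
    "HOL-Combinatorics.Permutations"
    "Jordan_Normal_Form.Char_Poly"
begin

text \<open>
  A finite-dimensional Hilbert space is given by a finite set \<open>I\<close> labelling an orthonormal basis, and
  an operator \<open>X\<close> on it by its matrix entries \<open>X i j\<close> = \<open>\<langle>i|X|j\<rangle>\<close> with \<open>i, j \<in> I\<close>; entries outside
  \<open>I\<close> are irrelevant.  The space of a composite system is labelled by the product of the label sets,
  and the \<open>n\<close>-fold tensor power by the strings of length \<open>n\<close>.  A classical register is a system
  labelled by its alphabet whose operators of interest are diagonal.
\<close>

type_synonym 'i opr = "'i \<Rightarrow> 'i \<Rightarrow> complex"

definition strings :: "'i set \<Rightarrow> nat \<Rightarrow> 'i list set" where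
  "strings I n = {xs. set xs \<subseteq> I \<and> length xs = n}"

subsection \<open>Operators\<close>

definition op_id :: "'i opr" where
  "op_id i j = (if i = j then 1 else 0)"

definition op_mult :: "'i set \<Rightarrow> 'i opr \<Rightarrow> 'i opr \<Rightarrow> 'i opr" where
  "op_mult I X Y i j = (\<Sum>k\<in>I. X i k * Y k j)"

definition op_adj :: "'i opr \<Rightarrow> 'i opr" where
  "op_adj X i j = cnj (X j i)"

definition op_trace :: "'i set \<Rightarrow> 'i opr \<Rightarrow> complex" where
  "op_trace I X = (\<Sum>i\<in>I. X i i)"

definition op_tensor :: "'i opr \<Rightarrow> 'j opr \<Rightarrow> ('i \<times> 'j) opr" where
  "op_tensor X Y p q = X (fst p) (fst q) * Y (snd p) (snd q)"

text \<open>The operator \<open>|i\<rangle>\<langle>j|\<close>.\<close>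
definition ketbra :: "'i \<Rightarrow> 'i \<Rightarrow> 'i opr" where
  "ketbra i j k l = (if k = i \<and> l = j then 1 else 0)"

text \<open>Over the complex numbers, membership of all the quadratic form values in the nonnegative
  reals includes that \<open>X\<close> is Hermitian.\<close>
definition op_psd :: "'i set \<Rightarrow> 'i opr \<Rightarrow> bool" where
  "op_psd I X \<longleftrightarrow> (\<forall>v. (\<Sum>i\<in>I. \<Sum>j\<in>I. cnj (v i) * X i j * v j) \<in> \<real>\<^sub>\<ge>\<^sub>0)"

definition is_state :: "'i set \<Rightarrow> 'i opr \<Rightarrow> bool" where
  "is_state I \<rho> \<longleftrightarrow> op_psd I \<rho> \<and> op_trace I \<rho> = 1"

definition is_povm :: "'i set \<Rightarrow> 'z set \<Rightarrow> ('z \<Rightarrow> 'i opr) \<Rightarrow> bool" where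
  "is_povm I Z M \<longleftrightarrow> (\<forall>z\<in>Z. op_psd I (M z)) \<and>
     (\<forall>i\<in>I. \<forall>j\<in>I. (\<Sum>z\<in>Z. M z i j) = op_id i j)"

subsection \<open>Permutations of tensor factors\<close>

text \<open>\<open>U(\<sigma>) |x\<^sub>0 \<dots> x\<^sub>n\<^sub>-\<^sub>1\<rangle>\<close> has the factor \<open>x\<^sub>k\<close> at position \<open>\<sigma> k\<close>.  Positions
  are counted from \<open>0\<close>, as for lists.\<close>
definition perm_op :: "(nat \<Rightarrow> nat) \<Rightarrow> 'i list opr" where
  "perm_op \<sigma> xs ys = (if xs = permute_list (inv_into UNIV \<sigma>) ys then 1 else 0)"

definition invariant_under :: "'i set \<Rightarrow> 'i opr \<Rightarrow> 'i opr \<Rightarrow> bool" where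
  "invariant_under I U X \<longleftrightarrow>
     (\<forall>i\<in>I. \<forall>j\<in>I. op_mult I (op_mult I U X) (op_adj U) i j = X i j)"

definition perm_invariant_fst :: "'i set \<Rightarrow> nat \<Rightarrow> 'j set \<Rightarrow> ('i list \<times> 'j) opr \<Rightarrow> bool" where
  "perm_invariant_fst I n J \<rho> \<longleftrightarrow>
     (\<forall>\<sigma>. \<sigma> permutes {..<n} \<longrightarrow>
        invariant_under (strings I n \<times> J) (op_tensor (perm_op \<sigma>) op_id) \<rho>)"

definition perm_invariant_snd :: "'i set \<Rightarrow> 'j set \<Rightarrow> nat \<Rightarrow> ('i \<times> 'j list) opr \<Rightarrow> bool" where
  "perm_invariant_snd I J n \<rho> \<longleftrightarrow>
     (\<forall>\<sigma>. \<sigma> permutes {..<n} \<longrightarrow>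
        invariant_under (I \<times> strings J n) (op_tensor op_id (perm_op \<sigma>)) \<rho>)"

subsection \<open>Channels\<close>

text \<open>The tensor product of linear maps on operators is the linear map determined by
  \<open>(\<Phi> \<otimes> \<Psi>)(|i\<rangle>\<langle>j| \<otimes> |k\<rangle>\<langle>l|) = \<Phi>(|i\<rangle>\<langle>j|) \<otimes> \<Psi>(|k\<rangle>\<langle>l|)\<close>, and likewise for tensor powers;
  the sets are the label sets of the input systems.\<close>
definition chan_tensor ::
  "'i set \<Rightarrow> 'j set \<Rightarrow> ('i opr \<Rightarrow> 'p opr) \<Rightarrow> ('j opr \<Rightarrow> 'q opr) \<Rightarrow> ('i \<times> 'j) opr \<Rightarrow> ('p \<times> 'q) opr" where
  "chan_tensor I J \<Phi> \<Psi> X p q =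
     (\<Sum>i\<in>I. \<Sum>j\<in>I. \<Sum>k\<in>J. \<Sum>l\<in>J.
        X (i, k) (j, l) * op_tensor (\<Phi> (ketbra i j)) (\<Psi> (ketbra k l)) p q)"

definition chan_power :: "'i set \<Rightarrow> nat \<Rightarrow> ('i opr \<Rightarrow> 'p opr) \<Rightarrow> 'i list opr \<Rightarrow> 'p list opr" where
  "chan_power I n \<Phi> X ps qs =
     (\<Sum>is\<in>strings I n. \<Sum>js\<in>strings I n.
        X is js * (\<Prod>k<n. \<Phi> (ketbra (is ! k) (js ! k)) (ps ! k) (qs ! k)))"

definition measure_chan :: "'i set \<Rightarrow> ('z \<Rightarrow> 'i opr) \<Rightarrow> 'i opr \<Rightarrow> 'z opr" where
  "measure_chan I M \<rho> z z' = (if z = z' then op_trace I (op_mult I (M z) \<rho>) else 0)"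

text \<open>The channel \<open>X \<mapsto> \<Sum>\<^sub>x \<langle>x|X|x\<rangle> |f x\<rangle>\<langle>f x|\<close>, which replaces a classical register holding
  \<open>x\<close> by one holding \<open>f x\<close>.\<close>
definition classical_chan :: "'x set \<Rightarrow> ('x \<Rightarrow> 't) \<Rightarrow> 'x opr \<Rightarrow> 't opr" where
  "classical_chan S f X t t' = (if t = t' then \<Sum>x | x \<in> S \<and> f x = t. X x x else 0)"

subsection \<open>Entropies\<close>

text \<open>Partial traces over the first and the second factor, labelled by \<open>I\<close> and \<open>J\<close>.\<close>
definition ptrace_fst :: "'i set \<Rightarrow> ('i \<times> 'j) opr \<Rightarrow> 'j opr" where
  "ptrace_fst I X k l = (\<Sum>i\<in>I. X (i, k) (i, l))"

definition ptrace_snd :: "'j set \<Rightarrow> ('i \<times> 'j) opr \<Rightarrow> 'i opr" where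
  "ptrace_snd J X i j = (\<Sum>k\<in>J. X (i, k) (j, k))"

text \<open>The middle factor of a tripartite system is traced out.\<close>
definition ptrace_mid :: "'j set \<Rightarrow> ('i \<times> 'j \<times> 'k) opr \<Rightarrow> ('i \<times> 'k) opr" where
  "ptrace_mid J X p q = (\<Sum>j\<in>J. X (fst p, j, snd p) (fst q, j, snd q))"

definition mat_of_op :: "'i set \<Rightarrow> 'i opr \<Rightarrow> complex mat" where
  "mat_of_op I X =
     mat (card I) (card I) (\<lambda>(k, l). X (from_nat_into I k) (from_nat_into I l))"

text \<open>\<open>H(\<rho>) = -tr \<rho> log \<rho>\<close> is the sum of \<open>-\<lambda> log \<lambda>\<close> over the eigenvalues \<open>\<lambda>\<close> of \<open>\<rho>\<close> counted with
  multiplicity.  The logarithm has base \<open>2\<close>, and the convention \<open>0 log 0 = 0\<close> holds automatically.\<close>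
definition vn_entropy :: "'i set \<Rightarrow> 'i opr \<Rightarrow> real" where
  "vn_entropy I \<rho> = (\<Sum>x\<in>#proots (char_poly (mat_of_op I \<rho>)). - (Re x * log 2 (Re x)))"

definition cond_entropy :: "'i set \<Rightarrow> 'k set \<Rightarrow> ('i \<times> 'k) opr \<Rightarrow> real" where
  "cond_entropy I K \<rho> = vn_entropy (I \<times> K) \<rho> - vn_entropy K (ptrace_fst I \<rho>)"

definition mutual_info :: "'i set \<Rightarrow> 'j set \<Rightarrow> ('i \<times> 'j) opr \<Rightarrow> real" where
  "mutual_info I J \<rho> =
     vn_entropy I (ptrace_snd J \<rho>) + vn_entropy J (ptrace_fst I \<rho>) - vn_entropy (I \<times> J) \<rho>"

text \<open>\<open>H(AB|C)\<close> groups the first two of three systems, hence the reassociation in the last term.\<close>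
definition cond_mutual_info ::
  "'i set \<Rightarrow> 'j set \<Rightarrow> 'k set \<Rightarrow> ('i \<times> 'j \<times> 'k) opr \<Rightarrow> real" where
  "cond_mutual_info I J K \<rho> =
     cond_entropy I K (ptrace_mid J \<rho>) + cond_entropy J K (ptrace_fst I \<rho>)
     - cond_entropy (I \<times> J) K (\<lambda>((i, j), k) ((i', j'), k'). \<rho> (i, j, k) (i', j', k'))"

subsection \<open>Type registers\<close>

definition type_of_string :: "'z list \<Rightarrow> 'z \<Rightarrow> nat" where
  "type_of_string zs = (\<lambda>z. count_list zs z)"

definition types :: "'z set \<Rightarrow> nat \<Rightarrow> ('z \<Rightarrow> nat) set" where
  "types Z m = type_of_string ` strings Z m"

text \<open>From \<open>zs = [z\<^sub>1, \<dots>, z\<^sub>n]\<close> and \<open>m < n\<close>, the first symbol \<open>z\<^sub>1\<close> and the type of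
  \<open>z\<^sub>2, \<dots>, z\<^sub>m\<^sub>+\<^sub>1\<close>.\<close>
definition first_and_type :: "nat \<Rightarrow> 'z list \<Rightarrow> 'z \<times> ('z \<Rightarrow> nat)" where
  "first_and_type m zs = (hd zs, type_of_string (take m (tl zs)))"

text \<open>For \<open>\<omega>\<close> on \<open>Y\<^sub>1\<^sup>n Z\<^sub>1\<^sup>n\<close>, the state on \<open>Y\<^sub>1\<close>, \<open>Z\<^sub>1\<close> and the pair of type registers.\<close>
definition double_type_state ::
  "'y set \<Rightarrow> 'z set \<Rightarrow> nat \<Rightarrow> nat \<Rightarrow> nat \<Rightarrow> ('y list \<times> 'z list) opr \<Rightarrow>
     ('y \<times> 'z \<times> ('y \<Rightarrow> nat) \<times> ('z \<Rightarrow> nat)) opr" where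
  "double_type_state Y Z n m\<^sub>A m\<^sub>B \<omega> =
     classical_chan (strings Y n \<times> strings Z n)
       (\<lambda>(ys, zs). let (y, s) = first_and_type m\<^sub>A ys; (z, t) = first_and_type m\<^sub>B zs
                   in (y, z, s, t)) \<omega>"

text \<open>For \<open>\<omega>\<close> on \<open>A Z\<^sub>1\<^sup>n\<close>, the state on \<open>A\<close>, \<open>Z\<^sub>1\<close> and the type register.\<close>
definition one_sided_type_state ::
  "'i set \<Rightarrow> 'z set \<Rightarrow> nat \<Rightarrow> nat \<Rightarrow> ('i \<times> 'z list) opr \<Rightarrow> ('i \<times> 'z \<times> ('z \<Rightarrow> nat)) opr" where
  "one_sided_type_state I Z n m \<omega> =
     chan_tensor I (strings Z n) (\<lambda>X. X) (classical_chan (strings Z n) (first_and_type m)) \<omega>"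

end

theory Submission
  imports Defs "Jordan_Normal_Form.Schur_Decomposition"
begin

text \<open>
  A classical register makes the operator block diagonal, and von Neumann entropy is additive over
  blocks.  By permutation invariance the block belonging to a string depends only on its type, so
  passing from the string register to the type register merges \<open>N\<close> equal blocks \<open>W\<close> into one block
  \<open>N W\<close>; this lowers the entropy by \<open>N log N tr W\<close>.  The correction is the same for all four
  entropies in \<open>I(A:B|T)\<close>, so it cancels, and \<open>I(A:B|T)\<close> is the conditional mutual information given
  the whole string.  Invariance also allows moving the first symbol behind the string, hence the
  terms \<open>I(A:Z\<^sub>1|Z\<^sub>2\<^sup>m\<^sup>+\<^sup>1)\<close> are differences of consecutive values of \<open>H(A Z\<^sub>1\<^sup>m) - H(Z\<^sub>1\<^sup>m)\<close> and the sum
  telescopes; in the two-sided case it telescopes in both directions.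
\<close>

subsection \<open>Eigenvalues with multiplicity\<close>

definition eigvals :: "'i set \<Rightarrow> 'i opr \<Rightarrow> complex multiset" where
  "eigvals I X = proots (char_poly (mat_of_op I X))"

text \<open>\<open>mat_of_op\<close> fixes the arbitrary enumeration \<open>from_nat_into\<close>.
  With the enumeration as a parameter, one adapted to an image or to a disjoint union of label sets
  can be chosen.\<close>

definition enum_mat :: "(nat \<Rightarrow> 'i) \<Rightarrow> nat \<Rightarrow> 'i opr \<Rightarrow> complex mat" where
  "enum_mat f n X = mat n n (\<lambda>(k, l). X (f k) (f l))"

lemma enum_mat_carrier [simp]: "enum_mat f n X \<in> carrier_mat n n"
  by (simp add: enum_mat_def)

text \<open>Two enumerations of the same basis differ by a permutation of it, so the matrices are
  conjugate by a permutation matrix.\<close>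

lemma enum_mat_similar:
  assumes f: "bij_betw f {..<n} I" and g: "bij_betw g {..<n} I"
  shows "similar_mat (enum_mat f n X) (enum_mat g n X)"
proof -
  \<comment> \<open>\<open>P f g\<close> has a 1 where \<open>f\<close> and \<open>g\<close> name
    the same label: the permutation matrix of the change of enumeration. Its inverse is
    \<open>P g f\<close>.\<close>
  define P where "P = (\<lambda>f g. mat n n (\<lambda>(k, l). if (f k :: 'a) = g l then 1 else (0 :: complex)))"
  have fin: "finite I" using f bij_betw_finite by blast
  have in_I: "h k \<in> I" if "bij_betw h {..<n} I" "k < n" for h k
    using that by (auto simp: bij_betw_def)
  have inj: "h k = h l \<longleftrightarrow> k = l" if "bij_betw h {..<n} I" "k < n" "l < n" for h k l
    using that by (auto simp: bij_betw_def inj_on_def)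
  have PP: "P f g * P g f = 1\<^sub>m n" if f: "bij_betw f {..<n} I" and g: "bij_betw g {..<n} I" for f g
  proof (rule eq_matI)
    fix k l assume "k < dim_row (1\<^sub>m n :: complex mat)" "l < dim_col (1\<^sub>m n :: complex mat)"
    hence kl: "k < n" "l < n" by auto
    have "(P f g * P g f) $$ (k, l) =
        (\<Sum>j<n. (if f k = g j then 1 else 0) * (if g j = f l then 1 else 0))"
      using kl by (simp add: P_def scalar_prod_def atLeast0LessThan)
    also have "\<dots> = (\<Sum>i\<in>I. (if f k = i then 1 else 0) * (if i = f l then 1 else 0))"
      by (rule sum.reindex_bij_betw[OF g])
    also have "\<dots> = (if f k = f l then 1 else 0)"
      using fin in_I[OF f] kl by (simp add: if_distrib[of "\<lambda>x. x * _"] sum.delta cong: if_cong)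
    finally show "(P f g * P g f) $$ (k, l) = 1\<^sub>m n $$ (k, l)"
      using inj[OF f kl] kl by simp
  qed (auto simp: P_def)
  have "enum_mat f n X = P f g * enum_mat g n X * P g f"
  proof (rule eq_matI)
    fix k l assume "k < dim_row (P f g * enum_mat g n X * P g f)" "l < dim_col (P f g * enum_mat g n X * P g f)"
    hence kl: "k < n" "l < n" by (auto simp: P_def)
    have 1: "(P f g * enum_mat g n X) $$ (k, j) = X (f k) (g j)" if "j < n" for j
    proof -
      have "(P f g * enum_mat g n X) $$ (k, j) = (\<Sum>m<n. (if f k = g m then 1 else 0) * X (g m) (g j))"
        using kl that by (simp add: P_def enum_mat_def scalar_prod_def atLeast0LessThan)
      also have "\<dots> = (\<Sum>i\<in>I. (if f k = i then 1 else 0) * X i (g j))"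
        by (rule sum.reindex_bij_betw[OF g])
      also have "\<dots> = X (f k) (g j)"
        using fin in_I[OF f] kl by (simp add: if_distrib[of "\<lambda>x. x * _"] sum.delta cong: if_cong)
      finally show ?thesis .
    qed
    have "(P f g * enum_mat g n X * P g f) $$ (k, l) =
        (\<Sum>j<n. (P f g * enum_mat g n X) $$ (k, j) * P g f $$ (j, l))"
      using kl by (simp add: P_def enum_mat_def scalar_prod_def atLeast0LessThan)
    also have "\<dots> = (\<Sum>j<n. X (f k) (g j) * (if g j = f l then 1 else 0))"
      using kl 1 by (intro sum.cong refl) (simp add: P_def)
    also have "\<dots> = (\<Sum>i\<in>I. X (f k) i * (if i = f l then 1 else 0))"
      by (rule sum.reindex_bij_betw[OF g])
    also have "\<dots> = X (f k) (f l)"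
      using fin in_I[OF f] kl by (simp add: if_distrib[of "\<lambda>x. _ * x"] sum.delta cong: if_cong)
    finally show "enum_mat f n X $$ (k, l) = (P f g * enum_mat g n X * P g f) $$ (k, l)"
      using kl by (simp add: enum_mat_def)
  qed (auto simp: P_def enum_mat_def)
  moreover have "{enum_mat f n X, enum_mat g n X, P f g, P g f} \<subseteq> carrier_mat n n"
    by (auto simp: P_def)
  ultimately show ?thesis
    using PP[OF f g] PP[OF g f] by (intro similar_matI)
qed

text \<open>Similar matrices share the characteristic polynomial, so eigenvalues may be computed
  with whichever enumeration is convenient.\<close>

lemma eigvals_enum:
  assumes "bij_betw f {..<n} I"
  shows "eigvals I X = proots (char_poly (enum_mat f n X))"
proof -
  have fin: "finite I" and n: "card I = n"
    using assms bij_betw_finite bij_betw_same_card by fastforce+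
  have "mat_of_op I X = enum_mat (from_nat_into I) n X"
    by (simp add: mat_of_op_def enum_mat_def n)
  moreover have "bij_betw (from_nat_into I) {..<n} I"
    using bij_betw_from_nat_into_finite[OF fin] n by simp
  ultimately show ?thesis
    using char_poly_similar[OF enum_mat_similar[OF assms]] by (simp add: eigvals_def)
qed

text \<open>Composing an enumeration of \<open>I\<close> with \<open>g\<close> enumerates
  \<open>J\<close>, and in these two enumerations the matrices coincide.\<close>

lemma eigvals_relabel:
  assumes "finite I" "bij_betw g I J" "\<And>i j. i \<in> I \<Longrightarrow> j \<in> I \<Longrightarrow> Y (g i) (g j) = X i j"
  shows "eigvals J Y = eigvals I X"
proof -
  let ?f = "from_nat_into I"
  have f: "bij_betw ?f {..<card I} I"
    by (rule bij_betw_from_nat_into_finite) fact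
  have "enum_mat (g \<circ> ?f) (card I) Y = enum_mat ?f (card I) X"
    using assms(3) bij_betwE[OF f] by (auto simp: enum_mat_def intro!: eq_matI)
  thus ?thesis
    using eigvals_enum[OF f] eigvals_enum[OF bij_betw_trans[OF f assms(2)]] by simp
qed

lemma eigvals_cong:
  assumes "finite I" "\<And>i j. i \<in> I \<Longrightarrow> j \<in> I \<Longrightarrow> Y i j = X i j"
  shows "eigvals I Y = eigvals I X"
  using eigvals_relabel[of I id I Y X] assms by simp

lemma eigvals_empty [simp]: "eigvals {} X = {#}"
proof -
  have "bij_betw (\<lambda>_. undefined) {..<0::nat} {}" by (simp add: bij_betw_def)
  hence "eigvals {} X = proots (char_poly (enum_mat (\<lambda>_. undefined) 0 X))" by (rule eigvals_enum)
  also have "char_poly (enum_mat (\<lambda>_. undefined) 0 X) = 1"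
    by (subst char_poly_upper_triangular[of _ 0]) (auto simp: diag_mat_def enum_mat_def)
  finally show ?thesis by simp
qed

text \<open>The characteristic polynomial is monic. Nonvanishing is what lets the root multisets of
  a product add up in \<open>eigvals_union\<close>.\<close>

lemma char_poly_nonzero:
  assumes "A \<in> carrier_mat n n"
  shows "char_poly A \<noteq> (0 :: complex poly)"
  using degree_monic_char_poly[OF assms] by auto

lemma eigvals_singleton [simp]: "eigvals {i} X = {#X i i#}"
proof -
  have "bij_betw (\<lambda>_. i) {..<1::nat} {i}" by (auto simp: bij_betw_def lessThan_Suc)
  hence "eigvals {i} X = proots (char_poly (enum_mat (\<lambda>_. i) 1 X))" by (rule eigvals_enum)
  also have "char_poly (enum_mat (\<lambda>_. i) 1 X) = [:- X i i, 1:]"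
    by (subst char_poly_upper_triangular[of _ 1]) (auto simp: diag_mat_def enum_mat_def)
  finally show ?thesis by simp
qed

text \<open>Listing \<open>I\<close> before \<open>J\<close> makes the matrix block diagonal; its
  characteristic polynomial is the product of those of the blocks, and the root multisets
  add.\<close>

lemma eigvals_union:
  assumes "finite I" "finite J" "I \<inter> J = {}"
    and "\<And>i j. i \<in> I \<Longrightarrow> j \<in> J \<Longrightarrow> X i j = 0 \<and> X j i = 0"
  shows "eigvals (I \<union> J) X = eigvals I X + eigvals J X"
proof -
  define m n where "m = card I" and "n = card J"
  \<comment> \<open>Positions below \<open>m\<close> run through \<open>I\<close>; the next
    \<open>n\<close> positions, shifted back by \<open>m\<close>, run through
    \<open>J\<close>.\<close>
  define f where "f = (\<lambda>k. if k < m then from_nat_into I k else from_nat_into J (k - m))"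
  have fI: "bij_betw (from_nat_into I) {..<m} I" and fJ: "bij_betw (from_nat_into J) {..<n} J"
    using assms bij_betw_from_nat_into_finite unfolding m_def n_def by blast+
  have inI: "k < m \<Longrightarrow> from_nat_into I k \<in> I" and inJ: "k < n \<Longrightarrow> from_nat_into J k \<in> J" for k
    using fI fJ by (auto simp: bij_betw_def)
  have fI': "bij_betw f {..<m} I"
    using fI by (rule bij_betw_cong[THEN iffD1, rotated]) (simp add: f_def)
  have "bij_betw (\<lambda>k. k - m) {m..<m+n} {..<n}"
    by (rule bij_betw_byWitness[of _ "\<lambda>k. k + m"]) auto
  from bij_betw_trans[OF this fJ] have "bij_betw f {m..<m+n} J"
    by (rule bij_betw_cong[THEN iffD1, rotated]) (simp add: f_def)
  hence "bij_betw f ({..<m} \<union> {m..<m+n}) (I \<union> J)"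
    using assms fI' by (intro bij_betw_combine)
  moreover have "{..<m} \<union> {m..<m+n} = {..<m+n}" by auto
  ultimately have f: "bij_betw f {..<m+n} (I \<union> J)" by simp
  let ?B = "enum_mat (from_nat_into I) m X" and ?D = "enum_mat (from_nat_into J) n X"
  have "enum_mat f (m + n) X = four_block_mat ?B (0\<^sub>m m n) (0\<^sub>m n m) ?D"
  proof (rule eq_matI)
    fix k l assume "k < dim_row (four_block_mat ?B (0\<^sub>m m n) (0\<^sub>m n m) ?D)"
      "l < dim_col (four_block_mat ?B (0\<^sub>m m n) (0\<^sub>m n m) ?D)"
    hence kl: "k < m + n" "l < m + n" by (auto simp: enum_mat_def)
    show "enum_mat f (m + n) X $$ (k, l) = four_block_mat ?B (0\<^sub>m m n) (0\<^sub>m n m) ?D $$ (k, l)"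
      using kl inI[of k] inI[of l] inJ[of "k - m"] inJ[of "l - m"] assms(4)
      by (auto simp: enum_mat_def f_def)
  qed (auto simp: enum_mat_def)
  from char_poly_0_block[OF this] char_poly_factorized[of ?B m] char_poly_factorized[of ?D n]
  have "char_poly (enum_mat f (m + n) X) = char_poly ?B * char_poly ?D" 
    by (metis enum_mat_carrier zero_carrier_mat)
  thus ?thesis
    using eigvals_enum[OF f] eigvals_enum[OF fI] eigvals_enum[OF fJ] char_poly_nonzero[of ?B m]
      char_poly_nonzero[of ?D n]
    by (simp add: proots_mult)
qed

section \<open>Trace and scaling of eigenvalues by triangularization\<close>

lemma mat_trace_comm:
  assumes "A \<in> carrier_mat n n" "B \<in> carrier_mat n n"
  shows "(\<Sum>i<n. (A * B) $$ (i, i)) = (\<Sum>i<n. (B * A) $$ (i, i) :: complex)"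
proof -
  have "(A * B) $$ (i, i) = (\<Sum>j<n. A $$ (i, j) * B $$ (j, i))"
    and "(B * A) $$ (i, i) = (\<Sum>j<n. A $$ (j, i) * B $$ (i, j))" if "i < n" for i
    using assms that by (auto simp: scalar_prod_def atLeast0LessThan mult.commute)
  thus ?thesis by (simp) (rule sum.swap)
qed

text \<open>Over the complex numbers the characteristic polynomial splits, so Schur decomposition
  applies. In the triangular form the eigenvalues stand on the diagonal.\<close>

lemma similar_triangular:
  assumes A: "(A :: complex mat) \<in> carrier_mat n n"
  obtains B P Q where "B \<in> carrier_mat n n" "upper_triangular B" "similar_mat_wit A B P Q"
proof -
  obtain es where "char_poly A = (\<Prod>a\<leftarrow>es. [:- a, 1:])"
    using char_poly_factorized[OF A] by blast
  from schur_decomposition_exists[OF A this] that show ?thesis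
    unfolding similar_mat_def by blast
qed

lemma proots_upper_triangular:
  assumes "(B :: complex mat) \<in> carrier_mat n n" "upper_triangular B"
  shows "proots (char_poly B) = image_mset (\<lambda>i. B $$ (i, i)) (mset_set {..<n})"
proof -
  have "char_poly B = (\<Prod>a\<leftarrow>diag_mat B. [:- a, 1:])"
    using char_poly_upper_triangular[OF assms] .
  also have "proots \<dots> = mset (diag_mat B)"
  proof -
    have "proots (\<Prod>a\<leftarrow>xs. [:- a, 1:]) = mset xs" for xs :: "complex list"
    proof (induction xs)
      case (Cons x xs)
      have "(\<Prod>a\<leftarrow>xs. [:- a, 1:]) \<noteq> (0 :: complex poly)" by (auto simp: prod_list_zero_iff)
      thus ?case using Cons by (simp add: proots_mult del: mult_pCons_left)
    qed simp
    thus ?thesis .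
  qed
  also have "\<dots> = image_mset (\<lambda>i. B $$ (i, i)) (mset_set {..<n})"
    using assms(1) by (simp add: diag_mat_def atLeast0LessThan mset_map)
  finally show ?thesis .
qed

text \<open>The eigenvalues add up to the diagonal sum of a triangular form \<open>B\<close>, and
  cyclicity of the trace carries this back through the similarity \<open>P * B * Q\<close>.\<close>

lemma sum_eigvals:
  assumes "finite I"
  shows "\<Sum>\<^sub># (eigvals I X) = op_trace I X"
proof -
  define n f where "n = card I" and "f = from_nat_into I"
  have f: "bij_betw f {..<n} I"
    using bij_betw_from_nat_into_finite[OF assms] by (simp add: n_def f_def)
  let ?A = "enum_mat f n X"
  obtain B P Q where B: "B \<in> carrier_mat n n" "upper_triangular B" and w: "similar_mat_wit ?A B P Q"
    using similar_triangular[OF enum_mat_carrier] .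
  note w' = similar_mat_witD2[OF enum_mat_carrier w]
  have "similar_mat ?A B" using w unfolding similar_mat_def by blast
  from char_poly_similar[OF this]
  have eigvals: "eigvals I X = image_mset (\<lambda>i. B $$ (i, i)) (mset_set {..<n})"
    using eigvals_enum[OF f] proots_upper_triangular[OF B] by simp
  have "\<Sum>\<^sub># (eigvals I X) = (\<Sum>i<n. B $$ (i, i))"
    by (simp add: eigvals sum_unfold_sum_mset)
  \<comment> \<open>\<open>Q * P\<close> is the identity; it is inserted so that \<open>P\<close>
    can be moved cyclically to the front.\<close>
  also have "\<dots> = (\<Sum>i<n. (B * (Q * P)) $$ (i, i))"
    using w' B by simp
  also have "\<dots> = (\<Sum>i<n. ((B * Q) * P) $$ (i, i))"
    using w' B by (subst assoc_mult_mat[of B n n Q n P n]) auto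
  also have "\<dots> = (\<Sum>i<n. (P * (B * Q)) $$ (i, i))"
    using w' B by (intro mat_trace_comm) auto
  also have "\<dots> = (\<Sum>i<n. ?A $$ (i, i))"
    using w' by (subst assoc_mult_mat[of P n n B n Q n, symmetric]) auto
  also have "\<dots> = (\<Sum>i<n. X (f i) (f i))"
    by (simp add: enum_mat_def)
  also have "\<dots> = op_trace I X"
    unfolding op_trace_def by (rule sum.reindex_bij_betw[OF f])
  finally show ?thesis .
qed

text \<open>The matrices \<open>P\<close> and \<open>Q\<close> that triangularize an operator also
  triangularize its multiple, with the diagonal scaled by \<open>c\<close>.\<close>

lemma eigvals_scale:
  assumes "finite I"
  shows "eigvals I (\<lambda>i j. c * X i j) = image_mset ((*) c) (eigvals I X)"
proof -
  define n f where "n = card I" and "f = from_nat_into I"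
  have f: "bij_betw f {..<n} I"
    using bij_betw_from_nat_into_finite[OF assms] by (simp add: n_def f_def)
  let ?A = "enum_mat f n X"
  obtain B P Q where B: "B \<in> carrier_mat n n" "upper_triangular B" and w: "similar_mat_wit ?A B P Q"
    using similar_triangular[OF enum_mat_carrier] .
  note w' = similar_mat_witD2[OF enum_mat_carrier w]
  have "similar_mat ?A B" using w unfolding similar_mat_def by blast
  from char_poly_similar[OF this]
  have eigvals: "eigvals I X = image_mset (\<lambda>i. B $$ (i, i)) (mset_set {..<n})"
    using eigvals_enum[OF f] proots_upper_triangular[OF B] by simp
  have "enum_mat f n (\<lambda>i j. c * X i j) = c \<cdot>\<^sub>m ?A"
    by (auto simp: enum_mat_def)
  also have "\<dots> = P * (c \<cdot>\<^sub>m B) * Q"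
    using w' by (metis mult_smult_assoc_mat mult_smult_distrib mult_carrier_mat)
  finally have "similar_mat (enum_mat f n (\<lambda>i j. c * X i j)) (c \<cdot>\<^sub>m B)"
    using w' by (intro similar_matI[where n = n and P = P and Q = Q]) auto
  moreover have "upper_triangular (c \<cdot>\<^sub>m B)" "c \<cdot>\<^sub>m B \<in> carrier_mat n n"
    using B by (auto simp: upper_triangular_def)
  ultimately have "eigvals I (\<lambda>i j. c * X i j) = image_mset (\<lambda>i. (c \<cdot>\<^sub>m B) $$ (i, i)) (mset_set {..<n})"
    using eigvals_enum[OF f] char_poly_similar proots_upper_triangular by metis
  also have "\<dots> = image_mset ((*) c) (image_mset (\<lambda>i. B $$ (i, i)) (mset_set {..<n}))"
    using B by (auto simp: multiset.map_comp intro!: image_mset_cong)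
  finally show ?thesis by (simp add: eigvals)
qed

subsection \<open>Entropy of block diagonal operators\<close>

definition xlog :: "real \<Rightarrow> real" where
  "xlog x = - (x * log 2 x)"

lemma vn_entropy_eigvals: "vn_entropy I X = (\<Sum>x\<in>#eigvals I X. xlog (Re x))"
  by (simp add: vn_entropy_def eigvals_def xlog_def)

lemma vn_entropy_relabel:
  assumes "finite I" "bij_betw g I J" "\<And>i j. i \<in> I \<Longrightarrow> j \<in> I \<Longrightarrow> Y (g i) (g j) = X i j"
  shows "vn_entropy J Y = vn_entropy I X"
  using eigvals_relabel[of I g J Y X] assms by (simp add: vn_entropy_eigvals)

lemma vn_entropy_cong:
  assumes "finite I" "\<And>i j. i \<in> I \<Longrightarrow> j \<in> I \<Longrightarrow> Y i j = X i j"
  shows "vn_entropy I Y = vn_entropy I X"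
  using eigvals_cong[of I Y X] assms by (simp add: vn_entropy_eigvals)

text \<open>The second factor is a classical register, and each label \<open>k\<close> contributes
  the spectrum of its own block. Blocks are unnormalized: the weight of \<open>k\<close> is
  contained in \<open>W k\<close>.\<close>

lemma vn_entropy_blocks:
  assumes "finite I" "finite K"
    and "\<And>i j k l. i \<in> I \<Longrightarrow> j \<in> I \<Longrightarrow> k \<in> K \<Longrightarrow> l \<in> K \<Longrightarrow>
      X (i, k) (j, l) = (if k = l then W k i j else 0)"
  shows "vn_entropy (I \<times> K) X = (\<Sum>k\<in>K. vn_entropy I (W k))"
  using assms(2,3)
proof (induction K rule: finite_induct)
  case empty
  show ?case by (simp add: vn_entropy_eigvals)
next
  case (insert k K)
  have eq: "I \<times> insert k K = (I \<times> {k}) \<union> (I \<times> K)" by auto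
  have "eigvals (I \<times> insert k K) X = eigvals (I \<times> {k}) X + eigvals (I \<times> K) X"
    unfolding eq using insert.hyps insert.prems assms(1) by (intro eigvals_union) auto
  moreover have "eigvals (I \<times> {k}) X = eigvals I (W k)"
    using assms(1) insert.prems
    by (intro eigvals_relabel[where g = "\<lambda>i. (i, k)"]) (auto simp: bij_betw_def inj_on_def)
  moreover have "vn_entropy (I \<times> K) X = (\<Sum>k\<in>K. vn_entropy I (W k))"
    using insert.prems by (intro insert.IH) auto
  ultimately show ?case
    using insert.hyps by (simp add: vn_entropy_eigvals)
qed

lemma vn_entropy_diag:
  assumes "finite K" "\<And>k l. k \<in> K \<Longrightarrow> l \<in> K \<Longrightarrow> k \<noteq> l \<Longrightarrow> X k l = 0"
  shows "vn_entropy K X = (\<Sum>k\<in>K. xlog (Re (X k k)))"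
proof -
  \<comment> \<open>A one-dimensional system is adjoined, which turns the diagonal entries into
    blocks of size one.\<close>
  have "vn_entropy K X = vn_entropy ({()} \<times> K) (\<lambda>p q. X (snd p) (snd q))"
    using assms(1) by (intro vn_entropy_relabel[where g = snd]) (auto simp: bij_betw_def inj_on_def)
  also have "\<dots> = (\<Sum>k\<in>K. vn_entropy {()} (\<lambda>_ _. X k k))"
    using assms by (intro vn_entropy_blocks) auto
  also have "\<dots> = (\<Sum>k\<in>K. xlog (Re (X k k)))"
    by (simp add: vn_entropy_eigvals)
  finally show ?thesis .
qed

text \<open>Summing \<open>xlog (c * x) = c * xlog x - c * log 2 c * x\<close> over the eigenvalues
  turns the last term into a trace.\<close>

lemma vn_entropy_scale:
  assumes "finite I" "c > 0"
  shows "vn_entropy I (\<lambda>i j. of_real c * X i j) =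
    c * vn_entropy I X - c * log 2 c * Re (op_trace I X)"
proof -
  \<comment> \<open>\<open>log_mult\<close> concerns nonzero factors; at \<open>x = 0\<close> both
    sides vanish.\<close>
  have x: "xlog (c * x) = c * xlog x - c * log 2 c * x" for x
    using assms(2) by (cases "x = 0") (auto simp: xlog_def log_mult algebra_simps)
  have "vn_entropy I (\<lambda>i j. of_real c * X i j) = (\<Sum>x\<in>#eigvals I X. xlog (c * Re x))"
    by (simp add: vn_entropy_eigvals eigvals_scale[OF assms(1)] multiset.map_comp o_def)
  also have "\<dots> = c * vn_entropy I X - c * log 2 c * (\<Sum>x\<in>#eigvals I X. Re x)"
  proof -
    have "(\<Sum>x\<in>#M. xlog (c * Re x)) =
        c * (\<Sum>x\<in>#M. xlog (Re x)) - c * log 2 c * (\<Sum>x\<in>#M. Re x)" for M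
      by (induction M) (simp_all add: x algebra_simps)
    thus ?thesis by (simp add: vn_entropy_eigvals)
  qed
  also have "(\<Sum>x\<in>#eigvals I X. Re x) = Re (op_trace I X)"
  proof -
    have "(\<Sum>x\<in>#M. Re x) = Re (\<Sum>\<^sub># M)" for M by (induction M) auto
    thus ?thesis using sum_eigvals[OF assms(1)] by simp
  qed
  finally show ?thesis .
qed

text \<open>The fibre of \<open>g\<close> over \<open>t\<close> consists of, say, N equal blocks,
  whose sum is N times one of them. By the scaling formula its entropy is that of the N separate
  blocks minus N log N times the trace of one block. The correction sees only fibre sizes and
  traces, so families of operators with the same traces share it.\<close>

lemma entropy_type_blocks:
  assumes "finite I" "finite V"
    and const: "\<And>v v' i j. v \<in> V \<Longrightarrow> v' \<in> V \<Longrightarrow> g v = g v' \<Longrightarrow> i \<in> I \<Longrightarrow> j \<in> I \<Longrightarrow> W v i j = W v' i j"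
  shows "(\<Sum>t\<in>g ` V. vn_entropy I (\<lambda>i j. \<Sum>v | v \<in> V \<and> g v = t. W v i j)) =
    (\<Sum>v\<in>V. vn_entropy I (W v)) -
    (\<Sum>v\<in>V. log 2 (card {u \<in> V. g u = g v}) * Re (op_trace I (W v)))"
proof -
  have "vn_entropy I (\<lambda>i j. \<Sum>v | v \<in> V \<and> g v = t. W v i j) =
      (\<Sum>v | v \<in> V \<and> g v = t. vn_entropy I (W v) -
        log 2 (card {u \<in> V. g u = g v}) * Re (op_trace I (W v)))" if t: "t \<in> g ` V" for t
  proof -
    \<comment> \<open>All blocks over \<open>t\<close> are compared with the one at a chosen
      \<open>v0\<close>, which exists because \<open>t\<close> lies in the image.\<close>
    obtain v0 where v0: "v0 \<in> V" "g v0 = t" using t by blast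
    define F where "F = {v \<in> V. g v = t}"
    have F: "finite F" "v0 \<in> F" using assms(2) v0 by (auto simp: F_def)
    hence pos: "card F > 0" by (auto simp: card_gt_0_iff)
    have W: "W v i j = W v0 i j" if "v \<in> F" "i \<in> I" "j \<in> I" for v i j
      using const[of v v0 i j] that v0 by (simp add: F_def)
    have "vn_entropy I (\<lambda>i j. \<Sum>v\<in>F. W v i j) = vn_entropy I (\<lambda>i j. of_real (card F) * W v0 i j)"
      using W assms(1) by (intro vn_entropy_cong) (auto cong: sum.cong)
    also have "\<dots> = card F * (vn_entropy I (W v0) - log 2 (card F) * Re (op_trace I (W v0)))"
      using pos by (subst vn_entropy_scale[OF assms(1)]) (auto simp: algebra_simps)
    also have "\<dots> = (\<Sum>v\<in>F. vn_entropy I (W v0) - log 2 (card F) * Re (op_trace I (W v0)))"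
      by simp
    \<comment> \<open>The multiple \<open>card F\<close> is spread back over the fibre, so that the
      result no longer refers to \<open>v0\<close>.\<close>
    also have "\<dots> = (\<Sum>v\<in>F. vn_entropy I (W v) -
        log 2 (card {u \<in> V. g u = g v}) * Re (op_trace I (W v)))"
    proof (rule sum.cong)
      fix v assume v: "v \<in> F"
      have "vn_entropy I (W v) = vn_entropy I (W v0)"
        using W v assms(1) by (intro vn_entropy_cong) auto
      moreover have "op_trace I (W v) = op_trace I (W v0)"
        using W v unfolding op_trace_def by (intro sum.cong) auto
      moreover have "{u \<in> V. g u = g v} = F" using v by (auto simp: F_def)
      ultimately show "vn_entropy I (W v0) - log 2 (card F) * Re (op_trace I (W v0)) =
          vn_entropy I (W v) - log 2 (card {u \<in> V. g u = g v}) * Re (op_trace I (W v))"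
        by simp
    qed simp
    finally show ?thesis unfolding F_def .
  qed
  hence "(\<Sum>t\<in>g ` V. vn_entropy I (\<lambda>i j. \<Sum>v | v \<in> V \<and> g v = t. W v i j)) =
      (\<Sum>t\<in>g ` V. \<Sum>v | v \<in> V \<and> g v = t. vn_entropy I (W v) -
        log 2 (card {u \<in> V. g u = g v}) * Re (op_trace I (W v)))"
    by (rule sum.cong[OF refl])
  also have "\<dots> = (\<Sum>v\<in>V. vn_entropy I (W v) -
      log 2 (card {u \<in> V. g u = g v}) * Re (op_trace I (W v)))"
    by (rule sum.image_gen[OF assms(2), symmetric])
  finally show ?thesis by (simp add: sum_subtractf)
qed

lemma op_trace_ptrace_snd: "op_trace I (ptrace_snd J X) = op_trace (I \<times> J) X"
  by (simp add: op_trace_def ptrace_snd_def sum.cartesian_product)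

lemma op_trace_ptrace_fst: "op_trace J (ptrace_fst I X) = op_trace (I \<times> J) X"
  unfolding op_trace_def ptrace_fst_def by (subst sum.swap) (simp add: sum.cartesian_product)

text \<open>\<open>W v\<close> is the unnormalized operator on the two systems given the string
  \<open>v\<close>. Its partial traces have the same trace as \<open>W v\<close>, so with K the type
  register, H(IK), H(JK), H(IJK) and H(K) all carry the same correction. Their signs are +, +, -, -,
  and it cancels. What remains is the conditional mutual information given \<open>v\<close>
  itself.\<close>

lemma cond_mutual_info_type_register:
  assumes fin: "finite I" "finite J" "finite V"
    and const: "\<And>v v' p q. v \<in> V \<Longrightarrow> v' \<in> V \<Longrightarrow> g v = g v' \<Longrightarrow> p \<in> I \<times> J \<Longrightarrow> q \<in> I \<times> J \<Longrightarrow>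
      W v p q = W v' p q"
    and R: "\<And>i j k i' j' k'. i \<in> I \<Longrightarrow> i' \<in> I \<Longrightarrow> j \<in> J \<Longrightarrow> j' \<in> J \<Longrightarrow> k \<in> g ` V \<Longrightarrow> k' \<in> g ` V \<Longrightarrow>
      R (i, j, k) (i', j', k') =
        (if k = k' then \<Sum>v | v \<in> V \<and> g v = k. W v (i, j) (i', j') else 0)"
  shows "cond_mutual_info I J (g ` V) R =
    (\<Sum>v\<in>V. vn_entropy I (ptrace_snd J (W v)) + vn_entropy J (ptrace_fst I (W v))
      - vn_entropy (I \<times> J) (W v) - xlog (Re (op_trace (I \<times> J) (W v))))"
proof -
  let ?K = "g ` V"
  let ?C = "\<Sum>v\<in>V. log 2 (card {u \<in> V. g u = g v}) * Re (op_trace (I \<times> J) (W v))"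
  let ?T = "(\<Sum>v\<in>V. xlog (Re (op_trace (I \<times> J) (W v)))) - ?C"
  have finK: "finite ?K" using fin by simp
  have c1: "ptrace_snd J (W v) i i' = ptrace_snd J (W v') i i'"
    if "v \<in> V" "v' \<in> V" "g v = g v'" "i \<in> I" "i' \<in> I" for v v' i i'
    unfolding ptrace_snd_def using that by (intro sum.cong refl const) auto
  have c2: "ptrace_fst I (W v) j j' = ptrace_fst I (W v') j j'"
    if "v \<in> V" "v' \<in> V" "g v = g v'" "j \<in> J" "j' \<in> J" for v v' j j'
    unfolding ptrace_fst_def using that by (intro sum.cong refl const) auto
  have c3: "op_trace (I \<times> J) (W v) = op_trace (I \<times> J) (W v')"
    if "v \<in> V" "v' \<in> V" "g v = g v'" for v v'
    unfolding op_trace_def using that by (intro sum.cong refl const) auto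
  have "vn_entropy (I \<times> ?K) (ptrace_mid J R) =
      (\<Sum>k\<in>?K. vn_entropy I (\<lambda>i i'. \<Sum>v | v \<in> V \<and> g v = k. ptrace_snd J (W v) i i'))"
    using fin finK
    by (intro vn_entropy_blocks)
      (auto simp: ptrace_mid_def ptrace_snd_def R cong: sum.cong intro: sum.swap)
  also have "\<dots> = (\<Sum>v\<in>V. vn_entropy I (ptrace_snd J (W v))) - ?C"
    unfolding op_trace_ptrace_snd[of I J, symmetric]
    by (intro entropy_type_blocks fin(1,3) c1) auto
  finally have 1: "vn_entropy (I \<times> ?K) (ptrace_mid J R) = \<dots>" .
  have "vn_entropy (J \<times> ?K) (ptrace_fst I R) =
      (\<Sum>k\<in>?K. vn_entropy J (\<lambda>j j'. \<Sum>v | v \<in> V \<and> g v = k. ptrace_fst I (W v) j j'))"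
    using fin finK
    by (intro vn_entropy_blocks) (auto simp: ptrace_fst_def R cong: sum.cong intro: sum.swap)
  also have "\<dots> = (\<Sum>v\<in>V. vn_entropy J (ptrace_fst I (W v))) - ?C"
    unfolding op_trace_ptrace_fst[of J I, symmetric]
    by (intro entropy_type_blocks fin(2,3) c2) auto
  finally have 2: "vn_entropy (J \<times> ?K) (ptrace_fst I R) = \<dots>" .
  let ?R = "\<lambda>((i, j), k) ((i', j'), k'). R (i, j, k) (i', j', k')"
  have "vn_entropy ((I \<times> J) \<times> ?K) ?R =
      (\<Sum>k\<in>?K. vn_entropy (I \<times> J) (\<lambda>p q. \<Sum>v | v \<in> V \<and> g v = k. W v p q))"
    using fin finK by (intro vn_entropy_blocks) (auto simp: R)
  also have "\<dots> = (\<Sum>v\<in>V. vn_entropy (I \<times> J) (W v)) - ?C"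
    using fin(1,2) by (intro entropy_type_blocks fin(3) const) auto
  finally have 3: "vn_entropy ((I \<times> J) \<times> ?K) ?R = \<dots>" .
  \<comment> \<open>The state of the register alone arises from three different partial traces;
    \<open>T\<close> covers all of them.\<close>
  have T: "vn_entropy ?K X = ?T"
    if X: "\<And>k l. k \<in> ?K \<Longrightarrow> l \<in> ?K \<Longrightarrow> X k l = (\<Sum>p\<in>I \<times> J. R (fst p, snd p, k) (fst p, snd p, l))"
    for X
  proof -
    have Xd: "X k l = (if k = l then \<Sum>v | v \<in> V \<and> g v = k. op_trace (I \<times> J) (W v) else 0)"
      if "k \<in> ?K" "l \<in> ?K" for k l
    proof -
      have "X k l = (\<Sum>p\<in>I \<times> J. if k = l then \<Sum>v | v \<in> V \<and> g v = k. W v p p else 0)"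
        unfolding X[OF that] using that by (intro sum.cong) (auto simp: R)
      thus ?thesis by (auto simp: op_trace_def intro: sum.swap)
    qed
    have "vn_entropy ?K X = (\<Sum>k\<in>?K. xlog (Re (X k k)))"
      using finK Xd by (intro vn_entropy_diag) auto
    \<comment> \<open>The weights of the types are read as operators on a one-dimensional system, so
      that \<open>entropy_type_blocks\<close> applies to the register alone too.\<close>
    also have "\<dots> = (\<Sum>k\<in>?K. vn_entropy {()} (\<lambda>_ _. \<Sum>v | v \<in> V \<and> g v = k. op_trace (I \<times> J) (W v)))"
      using Xd by (intro sum.cong) (auto simp: vn_entropy_eigvals)
    also have "\<dots> = (\<Sum>v\<in>V. vn_entropy {()} (\<lambda>_ _. op_trace (I \<times> J) (W v))) - 
        (\<Sum>v\<in>V. log 2 (card {u \<in> V. g u = g v}) * Re (op_trace {()} (\<lambda>_ _. op_trace (I \<times> J) (W v))))"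
      by (intro entropy_type_blocks fin(3) c3) auto
    also have "\<dots> = ?T"
      by (simp add: vn_entropy_eigvals) (simp add: op_trace_def)
    finally show ?thesis .
  qed
  have 4: "vn_entropy ?K (ptrace_fst I (ptrace_mid J R)) = ?T"
    by (rule T) (simp add: ptrace_fst_def ptrace_mid_def sum.cartesian_product case_prod_unfold)
  have 5: "vn_entropy ?K (ptrace_fst J (ptrace_fst I R)) = ?T"
    by (rule T, simp add: ptrace_fst_def, subst sum.swap)
       (simp add: sum.cartesian_product case_prod_unfold)
  have 6: "vn_entropy ?K (ptrace_fst (I \<times> J) ?R) = ?T"
    by (rule T) (simp add: ptrace_fst_def case_prod_unfold)
  show ?thesis
    unfolding cond_mutual_info_def cond_entropy_def 1 2 3 4 5 6
    by (simp add: sum.distrib sum_subtractf)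
qed

subsection \<open>Strings, types and marginals\<close>

lemma strings_0 [simp]: "strings I 0 = {[]}"
  by (auto simp: strings_def)

lemma finite_strings [simp]: "finite I \<Longrightarrow> finite (strings I n)"
  unfolding strings_def by (rule finite_lists_length_eq)

lemma sum_strings_append:
  "(\<Sum>x\<in>strings I (a + b). f x) = (\<Sum>u\<in>strings I a. \<Sum>v\<in>strings I b. f (u @ v))"
proof -
  have "bij_betw (\<lambda>(u, v). u @ v) (strings I a \<times> strings I b) (strings I (a + b))"
  proof (rule bij_betwI[where g = "\<lambda>x. (take a x, drop a x)"])
    show "(\<lambda>x. (take a x, drop a x)) \<in> strings I (a + b) \<rightarrow> strings I a \<times> strings I b"
      by (auto simp: strings_def dest: in_set_takeD in_set_dropD)
  qed (auto simp: strings_def)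
  from sum.reindex_bij_betw[OF this, of f] show ?thesis
    by (simp add: sum.cartesian_product case_prod_unfold)
qed

lemma sum_strings_Suc: "(\<Sum>x\<in>strings I (Suc n). f x) = (\<Sum>z\<in>I. \<Sum>v\<in>strings I n. f (z # v))"
proof -
  have "bij_betw (\<lambda>z. [z]) I (strings I 1)"
    by (rule bij_betwI[where g = hd]) (auto simp: strings_def length_Suc_conv)
  from sum.reindex_bij_betw[OF this, of "\<lambda>u. \<Sum>v\<in>strings I n. f (u @ v)"] show ?thesis
    using sum_strings_append[of f I 1 n] by simp
qed

section \<open>Symmetric functions of strings and their marginals\<close>

lemma type_of_string_eq_iff: "type_of_string v = type_of_string w \<longleftrightarrow> mset v = mset w"
  by (simp add: type_of_string_def multiset_eq_iff count_mset fun_eq_iff)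

text \<open>Permutation symmetry is phrased by multisets: strings are permutations of each other
  exactly if their multisets agree, and this is the same as having equal type.\<close>

definition symmetric_on :: "'z set \<Rightarrow> nat \<Rightarrow> ('z list \<Rightarrow> 'c) \<Rightarrow> bool" where
  "symmetric_on Z n h \<longleftrightarrow> (\<forall>x\<in>strings Z n. \<forall>y\<in>strings Z n. mset x = mset y \<longrightarrow> h x = h y)"

lemma symmetric_on_cong:
  assumes "\<And>x. x \<in> strings Z n \<Longrightarrow> g x = h x"
  shows "symmetric_on Z n g \<longleftrightarrow> symmetric_on Z n h"
  by (simp add: symmetric_on_def assms)

text \<open>With \<open>h\<close> an entry of the state as a function of the outcome string, this is
  the entry, at \<open>v\<close>, of the state reduced to the first \<open>m\<close>
  outcomes.\<close>

definition marginal :: "'z set \<Rightarrow> nat \<Rightarrow> ('z list \<Rightarrow> 'c) \<Rightarrow> nat \<Rightarrow> 'z list \<Rightarrow> 'c::comm_monoid_add" where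
  "marginal Z n h m v = (\<Sum>u\<in>strings Z (n - m). h (v @ u))"

lemma marginal_full [simp]: "marginal Z n h n v = h v"
  by (simp add: marginal_def)

lemma marginal_0 [simp]: "marginal Z n h 0 [] = (\<Sum>v\<in>strings Z n. h v)"
  by (simp add: marginal_def)

lemma marginal_symmetric:
  assumes "symmetric_on Z n h" "m \<le> n" "v \<in> strings Z m" "v' \<in> strings Z m" "mset v = mset v'"
  shows "marginal Z n h m v = marginal Z n h m v'"
  unfolding marginal_def
proof (rule sum.cong)
  fix u assume "u \<in> strings Z (n - m)"
  with assms have "v @ u \<in> strings Z n" "v' @ u \<in> strings Z n" "mset (v @ u) = mset (v' @ u)"
    by (auto simp: strings_def)
  with assms(1) show "h (v @ u) = h (v' @ u)" unfolding symmetric_on_def by blast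
qed simp

text \<open>The summed symbol stands in front of \<open>v\<close>. Symmetry moves it behind
  \<open>v\<close>, where it joins the symbols that the marginal sums out. This turns a register for
  positions 2 to m+1 into one for positions 1 to m.\<close>

lemma sum_marginal_Cons:
  assumes "symmetric_on Z n h" "m < n" "v \<in> strings Z m"
  shows "(\<Sum>z\<in>Z. marginal Z n h (Suc m) (z # v)) = marginal Z n h m v"
proof -
  have "h (z # v @ u) = h (v @ z # u)" if "z \<in> Z" "u \<in> strings Z (n - Suc m)" for z u
  proof -
    have "z # v @ u \<in> strings Z n" "v @ z # u \<in> strings Z n" "mset (z # v @ u) = mset (v @ z # u)"
      using assms that by (auto simp: strings_def)
    with assms(1) show ?thesis unfolding symmetric_on_def by blast
  qed
  hence "(\<Sum>z\<in>Z. marginal Z n h (Suc m) (z # v)) =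
      (\<Sum>z\<in>Z. \<Sum>u\<in>strings Z (n - Suc m). h (v @ z # u))"
    by (simp add: marginal_def)
  also have "\<dots> = (\<Sum>u\<in>strings Z (Suc (n - Suc m)). h (v @ u))"
    by (rule sum_strings_Suc[symmetric])
  finally show ?thesis
    using assms(2) by (simp add: marginal_def Suc_diff_Suc)
qed

lemma marginal_swap:
  "marginal Y n (\<lambda>u. marginal Z k (f u) b z) a y = marginal Z k (\<lambda>w. marginal Y n (\<lambda>u. f u w) a y) b z"
  unfolding marginal_def by (rule sum.swap)

text \<open>Symmetry in one register survives summing out part of the other, because it holds for
  each fixed string \<open>z @ v\<close> there.\<close>

lemma symmetric_on_marginal:
  assumes "\<And>w. w \<in> strings Z k \<Longrightarrow> symmetric_on Y n (\<lambda>u. f u w)" "b \<le> k" "z \<in> strings Z b"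
  shows "symmetric_on Y n (\<lambda>u. marginal Z k (f u) b z)"
  unfolding symmetric_on_def marginal_def
proof (intro ballI impI sum.cong refl)
  fix x y v assume xy: "x \<in> strings Y n" "y \<in> strings Y n" "mset x = mset y" "v \<in> strings Z (k - b)"
  have "z @ v \<in> strings Z k" using assms(2,3) xy(4) by (auto simp: strings_def)
  from assms(1)[OF this] show "f x (z @ v) = f y (z @ v)"
    using xy unfolding symmetric_on_def by blast
qed

text \<open>Strings split as \<open>z # v @ u\<close> with \<open>v\<close> of length
  \<open>m\<close>. The register looks only at \<open>z\<close> and the type of \<open>v\<close>, so
  the sum over \<open>u\<close> is the marginal on m+1 symbols.\<close>

lemma sum_first_and_type:
  assumes "finite Z" "m < n" "z \<in> Z"
  shows "(\<Sum>x | x \<in> strings Z n \<and> first_and_type m x = (z, t). h x) =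
    (\<Sum>v | v \<in> strings Z m \<and> type_of_string v = t. marginal Z n h (Suc m) (z # v))"
proof -
  \<comment> \<open>One leading symbol, \<open>m\<close> symbols seen by the type, and
    \<open>n - Suc m\<close> ignored ones; this split rests on \<open>m < n\<close>.\<close>
  have n: "n = Suc (m + (n - Suc m))" using assms(2) by simp
  have "(\<Sum>x | x \<in> strings Z n \<and> first_and_type m x = (z, t). h x) =
      (\<Sum>x\<in>strings Z n. if first_and_type m x = (z, t) then h x else 0)"
    using assms(1) by (simp add: sum.inter_filter)
  also have "\<dots> = (\<Sum>z'\<in>Z. \<Sum>v\<in>strings Z m. \<Sum>u\<in>strings Z (n - Suc m).
      if first_and_type m (z' # v @ u) = (z, t) then h (z' # v @ u) else 0)"
    by (subst n) (simp only: sum_strings_Suc sum_strings_append)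
  also have "\<dots> = (\<Sum>z'\<in>Z. if z' = z then (\<Sum>v\<in>strings Z m.
      if type_of_string v = t then marginal Z n h (Suc m) (z # v) else 0) else 0)"
    by (intro sum.cong refl)
      (auto simp: first_and_type_def marginal_def strings_def intro!: sum.cong)
  also have "\<dots> = (\<Sum>v | v \<in> strings Z m \<and> type_of_string v = t. marginal Z n h (Suc m) (z # v))"
    using assms by (simp add: sum.inter_filter)
  finally show ?thesis .
qed

section \<open>The states with type registers, expressed by marginals\<close>

lemma chan_tensor_id:
  assumes "finite I" "a \<in> I" "a' \<in> I"
  shows "chan_tensor I J (\<lambda>X. X) \<Psi> X (a, q) (a', q') =
    (\<Sum>k\<in>J. \<Sum>l\<in>J. X (a, k) (a', l) * \<Psi> (ketbra k l) q q')"
proof -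
  have "chan_tensor I J (\<lambda>X. X) \<Psi> X (a, q) (a', q') =
      (\<Sum>i\<in>I. if i = a then \<Sum>j\<in>I. if j = a' then
        \<Sum>k\<in>J. \<Sum>l\<in>J. X (a, k) (a', l) * \<Psi> (ketbra k l) q q' else 0 else 0)"
    unfolding chan_tensor_def
    by (intro sum.cong refl) (auto simp: op_tensor_def ketbra_def intro!: sum.cong)
  thus ?thesis using assms by simp
qed

text \<open>This is the block form that \<open>cond_mutual_info_type_register\<close> expects:
  diagonal in the type, with a sum over the strings of that type.\<close>

lemma one_sided_type_state_eq:
  assumes "finite I" "finite Z" "a \<in> I" "a' \<in> I" "z \<in> Z" "m < n"
  shows "one_sided_type_state I Z n m \<omega> (a, z, t) (a', z', t') =
    (if z = z' \<and> t = t' then \<Sum>v | v \<in> strings Z m \<and> type_of_string v = t.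
      marginal Z n (\<lambda>x. \<omega> (a, x) (a', x)) (Suc m) (z # v) else 0)"
proof -
  let ?S = "strings Z n"
  have "one_sided_type_state I Z n m \<omega> (a, z, t) (a', z', t') =
      (\<Sum>k\<in>?S. \<Sum>l\<in>?S. \<omega> (a, k) (a', l) *
        classical_chan ?S (first_and_type m) (ketbra k l) (z, t) (z', t'))"
    unfolding one_sided_type_state_def using assms by (intro chan_tensor_id)
  also have "\<dots> = (\<Sum>k\<in>?S. if (z, t) = (z', t') \<and> first_and_type m k = (z, t)
      then \<omega> (a, k) (a', k) else 0)"
  proof (rule sum.cong[OF refl])
    fix k assume k: "k \<in> ?S"
    \<comment> \<open>A classical register reads only diagonal entries, so of the matrix units
      \<open>ketbra k l\<close> only those with \<open>l = k\<close> survive.\<close>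
    have "classical_chan ?S (first_and_type m) (ketbra k l) (z, t) (z', t') =
        (if l = k then if (z, t) = (z', t') \<and> first_and_type m k = (z, t) then 1 else 0 else 0)"
      for l
    proof -
      have "(\<Sum>x | x \<in> ?S \<and> first_and_type m x = (z, t). ketbra k l x x) =
          (\<Sum>x | x \<in> ?S \<and> first_and_type m x = (z, t). if x = k then if l = k then 1 else 0 else 0)"
        by (intro sum.cong) (auto simp: ketbra_def)
      thus ?thesis using assms k by (auto simp: classical_chan_def)
    qed
    thus "(\<Sum>l\<in>?S. \<omega> (a, k) (a', l) *
        classical_chan ?S (first_and_type m) (ketbra k l) (z, t) (z', t')) =
      (if (z, t) = (z', t') \<and> first_and_type m k = (z, t) then \<omega> (a, k) (a', k) else 0)"
      using assms k by (simp add: if_distrib[of "\<lambda>x. _ * x"] cong: if_cong)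
  qed
  also have "\<dots> = (if z = z' \<and> t = t' then
      \<Sum>k | k \<in> ?S \<and> first_and_type m k = (z, t). \<omega> (a, k) (a', k) else 0)"
    using assms by (auto simp: sum.inter_filter)
  finally show ?thesis
    using sum_first_and_type[OF assms(2,6,5), where t = t and h = "\<lambda>x. \<omega> (a, x) (a', x)"] by auto
qed

lemma double_type_state_eq:
  assumes "finite Y" "finite Z" "y \<in> Y" "z \<in> Z" "a < n" "b < n"
  shows "double_type_state Y Z n a b \<omega> (y, z, s, t) (y', z', s', t') =
    (if y = y' \<and> z = z' \<and> s = s' \<and> t = t' then
      \<Sum>v | v \<in> strings Y a \<times> strings Z b \<and> map_prod type_of_string type_of_string v = (s, t).
        marginal Y n (\<lambda>u. marginal Z n (\<lambda>w. \<omega> (u, w) (u, w)) (Suc b) (z # snd v)) (Suc a) (y # fst v)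
     else 0)"
proof -
  let ?f = "\<lambda>(ys, zs). let (y, s) = first_and_type a ys; (z, t) = first_and_type b zs
    in (y, z, s, t)"
  let ?h = "\<lambda>w' u. marginal Z n (\<lambda>w. \<omega> (u, w) (u, w)) (Suc b) w'"
  \<comment> \<open>The conditions on the two strings are independent, so the fibre is a product and
    each register can be summed by itself.\<close>
  have set: "{x. x \<in> strings Y n \<times> strings Z n \<and> ?f x = (y, z, s, t)} =
      {u. u \<in> strings Y n \<and> first_and_type a u = (y, s)} \<times>
      {w. w \<in> strings Z n \<and> first_and_type b w = (z, t)}"
    by (auto simp: Let_def case_prod_unfold prod_eq_iff)
  have "(\<Sum>x | x \<in> strings Y n \<times> strings Z n \<and> ?f x = (y, z, s, t). \<omega> x x) =
      (\<Sum>u | u \<in> strings Y n \<and> first_and_type a u = (y, s).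
        \<Sum>w | w \<in> strings Z n \<and> first_and_type b w = (z, t). \<omega> (u, w) (u, w))"
    unfolding set by (simp add: sum.cartesian_product case_prod_unfold)
  also have "\<dots> = (\<Sum>v' | v' \<in> strings Z b \<and> type_of_string v' = t.
      \<Sum>u | u \<in> strings Y n \<and> first_and_type a u = (y, s). ?h (z # v') u)"
    unfolding sum_first_and_type[OF assms(2,6,4)] by (rule sum.swap)
  also have "\<dots> = (\<Sum>v' | v' \<in> strings Z b \<and> type_of_string v' = t.
      \<Sum>v | v \<in> strings Y a \<and> type_of_string v = s. marginal Y n (?h (z # v')) (Suc a) (y # v))"
    unfolding sum_first_and_type[OF assms(1,5,3)] ..
  also have "\<dots> = (\<Sum>v\<in>{v. v \<in> strings Y a \<and> type_of_string v = s} \<times> {v. v \<in> strings Z b \<and> type_of_string v = t}.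
       marginal Y n (?h (z # snd v)) (Suc a) (y # fst v))"
    by (subst sum.swap) (simp add: sum.cartesian_product case_prod_unfold)
  also have "{v. v \<in> strings Y a \<and> type_of_string v = s} \<times> {v. v \<in> strings Z b \<and> type_of_string v = t} =
      {v. v \<in> strings Y a \<times> strings Z b \<and> map_prod type_of_string type_of_string v = (s, t)}"
    by auto
  finally show ?thesis by (auto simp: double_type_state_def classical_chan_def)
qed

subsection \<open>Measured states\<close>

text \<open>This is the trace of \<open>X\<close> against the tensor product of the
  \<open>M (z ! i)\<close>; the trace pairs the entry \<open>k\<close>, \<open>l\<close> of
  \<open>X\<close> with the entry \<open>l\<close>, \<open>k\<close> of the effects.
  \<open>X\<close> may also be an off-diagonal slice of a larger state.\<close>

definition measured :: "'i set \<Rightarrow> ('z \<Rightarrow> 'i opr) \<Rightarrow> nat \<Rightarrow> 'i list opr \<Rightarrow> 'z list \<Rightarrow> complex" where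
  "measured I M n X z =
    (\<Sum>k\<in>strings I n. \<Sum>l\<in>strings I n. X k l * (\<Prod>i<n. M (z ! i) (l ! i) (k ! i)))"

lemma measure_chan_ketbra:
  assumes "finite I" "i \<in> I" "j \<in> I"
  shows "measure_chan I M (ketbra i j) z z' = (if z = z' then M z j i else 0)"
proof -
  have "(\<Sum>k\<in>I. M z p k * ketbra i j k p) = (\<Sum>k\<in>I. if k = i then if p = j then M z p i else 0 else 0)"
    for p
    by (intro sum.cong) (auto simp: ketbra_def)
  hence "(\<Sum>p\<in>I. \<Sum>k\<in>I. M z p k * ketbra i j k p) = M z j i"
    using assms by simp
  thus ?thesis by (auto simp: measure_chan_def op_trace_def op_mult_def)
qed

text \<open>On a matrix unit the power factors over the positions. Each factor vanishes unless the
  two outcome symbols agree, so the output is diagonal in the whole string.\<close>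

lemma chan_power_ketbra:
  assumes "finite I" "k \<in> strings I n" "l \<in> strings I n" "length z = n" "length z' = n"
  shows "chan_power I n (measure_chan I M) (ketbra k l) z z' =
    (if z = z' then \<Prod>i<n. M (z ! i) (l ! i) (k ! i) else 0)"
proof -
  let ?P = "\<lambda>k l. \<Prod>i<n. measure_chan I M (ketbra (k ! i) (l ! i)) (z ! i) (z' ! i)"
  have "chan_power I n (measure_chan I M) (ketbra k l) z z' =
      (\<Sum>k'\<in>strings I n. if k' = k then \<Sum>l'\<in>strings I n. if l' = l then ?P k l else 0 else 0)"
    unfolding chan_power_def by (intro sum.cong refl) (auto simp: ketbra_def intro!: sum.cong)
  also have "\<dots> = ?P k l" using assms by simp
  also have "\<dots> = (\<Prod>i<n. if z ! i = z' ! i then M (z ! i) (l ! i) (k ! i) else 0)"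
    using assms by (intro prod.cong refl measure_chan_ketbra) (auto simp: strings_def)
  also have "\<dots> = (if z = z' then \<Prod>i<n. M (z ! i) (l ! i) (k ! i) else 0)"
    using assms by (auto simp: list_eq_iff_nth_eq)
  finally show ?thesis .
qed

lemma measured_snd:
  assumes "finite I" "finite J" "a \<in> I" "a' \<in> I" "length z = n" "length z' = n"
  shows "chan_tensor I (strings J n) (\<lambda>X. X) (chan_power J n (measure_chan J M)) \<rho> (a, z) (a', z') =
    (if z = z' then measured J M n (\<lambda>k l. \<rho> (a, k) (a', l)) z else 0)"
proof -
  have "chan_tensor I (strings J n) (\<lambda>X. X) (chan_power J n (measure_chan J M)) \<rho> (a, z) (a', z') =
      (\<Sum>k\<in>strings J n. \<Sum>l\<in>strings J n. \<rho> (a, k) (a', l) *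
        (if z = z' then \<Prod>i<n. M (z ! i) (l ! i) (k ! i) else 0))"
    unfolding chan_tensor_id[OF assms(1,3,4)]
    by (intro sum.cong refl arg_cong2[where f = "(*)"] chan_power_ketbra assms(2,5,6))
  thus ?thesis by (cases "z = z'") (simp_all add: measured_def)
qed

text \<open>The channels act on different factors, so the second system can be measured first for
  each pair of labels of the other one. The nesting lets facts about one register be used
  twice.\<close>

lemma measured_both:
  assumes "finite I" "finite J" "length y = n" "length y' = n" "length z = n" "length z' = n"
  shows "chan_tensor (strings I n) (strings J n) (chan_power I n (measure_chan I M))
      (chan_power J n (measure_chan J N)) \<rho> (y, z) (y', z') =
    (if y = y' \<and> z = z' then
      measured I M n (\<lambda>i j. measured J N n (\<lambda>k l. \<rho> (i, k) (j, l)) z) y else 0)"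
proof -
  have "chan_tensor (strings I n) (strings J n) (chan_power I n (measure_chan I M))
      (chan_power J n (measure_chan J N)) \<rho> (y, z) (y', z') =
    (\<Sum>i\<in>strings I n. \<Sum>j\<in>strings I n. \<Sum>k\<in>strings J n. \<Sum>l\<in>strings J n. \<rho> (i, k) (j, l) *
      ((if y = y' then \<Prod>m<n. M (y ! m) (j ! m) (i ! m) else 0) *
       (if z = z' then \<Prod>m<n. N (z ! m) (l ! m) (k ! m) else 0)))"
    unfolding chan_tensor_def op_tensor_def fst_conv snd_conv
    by (intro sum.cong refl arg_cong2[where f = "(*)"] chan_power_ketbra assms)
  also have "\<dots> = (\<Sum>i\<in>strings I n. \<Sum>j\<in>strings I n. (\<Sum>k\<in>strings J n. \<Sum>l\<in>strings J n. \<rho> (i, k) (j, l) *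
       (if z = z' then \<Prod>m<n. N (z ! m) (l ! m) (k ! m) else 0)) *
      (if y = y' then \<Prod>m<n. M (y ! m) (j ! m) (i ! m) else 0))"
    unfolding sum_distrib_right by (intro sum.cong refl) (simp only: mult_ac)
  finally show ?thesis
    by (cases "y = y'"; cases "z = z'") (simp_all add: measured_def)
qed

text \<open>If \<open>x\<close> is \<open>y\<close> permuted by \<open>\<sigma>\<close>, rows and
  columns are reindexed by the same permutation: \<open>X\<close> does not change, and the product
  of effects is only reordered.\<close>

lemma measured_symmetric:
  assumes "finite I"
    and X: "\<And>\<sigma> k l. \<sigma> permutes {..<n} \<Longrightarrow> k \<in> strings I n \<Longrightarrow> l \<in> strings I n \<Longrightarrow>
      X (permute_list \<sigma> k) (permute_list \<sigma> l) = X k l"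
  shows "symmetric_on Z n (measured I M n X)"
  unfolding symmetric_on_def
proof (intro ballI impI)
  fix x y assume xy: "x \<in> strings Z n" "y \<in> strings Z n" "mset x = mset y"
  obtain \<sigma> where "\<sigma> permutes {..<length y}" and \<sigma>2: "permute_list \<sigma> y = x"
    using mset_eq_permutation[OF xy(3)] .
  with xy(2) have \<sigma>: "\<sigma> permutes {..<n}" "permute_list \<sigma> y = x"
    by (auto simp: strings_def)
  let ?g = "permute_list \<sigma>"
  have "bij_betw ?g (strings I n) (strings I n)"
  proof (rule bij_betwI[where g = "permute_list (inv_into UNIV \<sigma>)"])
    show "permute_list (inv_into UNIV \<sigma>) (?g k) = k" "?g (permute_list (inv_into UNIV \<sigma>) k) = k"
      if "k \<in> strings I n" for k
      using that \<sigma>(1) permutes_inv[OF \<sigma>(1)]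
      by (simp_all add: strings_def permutes_inv_o flip: permute_list_compose)
  qed (use \<sigma>(1) permutes_inv[OF \<sigma>(1)] in \<open>auto simp: strings_def\<close>)
  \<comment> \<open>Permuting positions is a bijection of the strings, used once for the row label
    and once for the column label.\<close>
  note reindex = sum.reindex_bij_betw[OF this, symmetric]
  have P: "(\<Prod>i<n. M (x ! i) (?g l ! i) (?g k ! i)) = (\<Prod>i<n. M (y ! i) (l ! i) (k ! i))"
    if "k \<in> strings I n" "l \<in> strings I n" for k l
  proof -
    have "(\<Prod>i<n. M (x ! i) (?g l ! i) (?g k ! i)) = (\<Prod>i<n. M (y ! \<sigma> i) (l ! \<sigma> i) (k ! \<sigma> i))"
    proof (intro prod.cong refl)
      fix i assume "i \<in> {..<n}"
      moreover have "length k = n" "length l = n" "length y = n"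
        using that xy(2) by (auto simp: strings_def)
      ultimately have "x ! i = y ! \<sigma> i" "?g k ! i = k ! \<sigma> i" "?g l ! i = l ! \<sigma> i"
        unfolding \<sigma>(2)[symmetric] using \<sigma>(1) by (auto intro: permute_list_nth)
      thus "M (x ! i) (?g l ! i) (?g k ! i) = M (y ! \<sigma> i) (l ! \<sigma> i) (k ! \<sigma> i)" by simp
    qed
    also have "\<dots> = (\<Prod>i<n. M (y ! i) (l ! i) (k ! i))"
      by (rule prod.reindex_bij_betw[OF permutes_imp_bij[OF \<sigma>(1)]])
    finally show ?thesis .
  qed
  have "measured I M n X x = (\<Sum>k\<in>strings I n. \<Sum>l\<in>strings I n.
      X (?g k) l * (\<Prod>i<n. M (x ! i) (l ! i) (?g k ! i)))"
    unfolding measured_def by (rule reindex)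
  also have "\<dots> = (\<Sum>k\<in>strings I n. \<Sum>l\<in>strings I n.
      X (?g k) (?g l) * (\<Prod>i<n. M (x ! i) (?g l ! i) (?g k ! i)))"
    by (rule sum.cong[OF refl], rule reindex)
  also have "\<dots> = measured I M n X y"
    unfolding measured_def by (intro sum.cong refl) (simp only: X[OF \<sigma>(1)] P)
  finally show "measured I M n X x = measured I M n X y" .
qed

lemma sum_strings_prod:
  "(\<Sum>z\<in>strings Z n. \<Prod>i<n. f i (z ! i)) = (\<Prod>i<n. \<Sum>z\<in>Z. f i z :: complex)"
proof (induction n arbitrary: f)
  case (Suc n)
  show ?case
    using Suc[of "\<lambda>i. f (Suc i)"]
    by (simp add: sum_strings_Suc prod.lessThan_Suc_shift del: prod.lessThan_Suc
        flip: sum_distrib_left sum_distrib_right)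
qed simp

text \<open>At each position the effects sum to the identity, so only \<open>l = k\<close> survives.
  Measuring thus preserves the trace, which supplies the normalization at the ends of the
  telescoping sums.\<close>

lemma sum_measured:
  assumes "is_povm I Z M" "finite I"
  shows "(\<Sum>z\<in>strings Z n. measured I M n X z) = op_trace (strings I n) X"
proof -
  have P: "(\<Sum>z\<in>strings Z n. \<Prod>i<n. M (z ! i) (l ! i) (k ! i)) = (if l = k then 1 else 0)"
    if "k \<in> strings I n" "l \<in> strings I n" for k l
  proof -
    have "(\<Sum>z\<in>strings Z n. \<Prod>i<n. M (z ! i) (l ! i) (k ! i)) =
        (\<Prod>i<n. \<Sum>z\<in>Z. M z (l ! i) (k ! i))"
      by (rule sum_strings_prod[of "\<lambda>i z. M z (l ! i) (k ! i)"])
    also have "\<dots> = (\<Prod>i<n. if l ! i = k ! i then 1 else 0)"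
    proof (intro prod.cong refl)
      fix i assume "i \<in> {..<n}"
      hence "k ! i \<in> I" "l ! i \<in> I" using that by (auto simp: strings_def subset_iff)
      thus "(\<Sum>z\<in>Z. M z (l ! i) (k ! i)) = (if l ! i = k ! i then 1 else 0)"
        using assms(1) by (simp add: is_povm_def op_id_def)
    qed
    also have "\<dots> = (if l = k then 1 else 0)"
      using that by (auto simp: list_eq_iff_nth_eq strings_def)
    finally show ?thesis .
  qed
  have "(\<Sum>z\<in>strings Z n. measured I M n X z) = (\<Sum>k\<in>strings I n. \<Sum>l\<in>strings I n.
      X k l * (\<Sum>z\<in>strings Z n. \<Prod>i<n. M (z ! i) (l ! i) (k ! i)))"
    unfolding measured_def sum_distrib_left
    by (subst sum.swap, rule sum.cong[OF refl], subst sum.swap) simp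
  also have "\<dots> = (\<Sum>k\<in>strings I n. \<Sum>l\<in>strings I n. if l = k then X k k else 0)"
    using P by (intro sum.cong refl) auto
  finally show ?thesis using assms(2) by (simp add: op_trace_def)
qed

section \<open>Permutation invariance in terms of matrix entries\<close>

lemma invariant_under_function:
  assumes "finite I" "invariant_under I U X"
    and U: "\<And>i j. i \<in> I \<Longrightarrow> j \<in> I \<Longrightarrow> U i j = (if j = g i then 1 else 0)"
    and g: "\<And>i. i \<in> I \<Longrightarrow> g i \<in> I"
    and "i \<in> I" "j \<in> I"
  shows "X (g i) (g j) = X i j"
proof -
  \<comment> \<open>Row \<open>i\<close> of \<open>U\<close> has its single 1 in column
    \<open>g i\<close>, so multiplying by \<open>U\<close> from the left reads row
    \<open>g i\<close>; the adjoint on the right does the same for columns.\<close>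
  have 1: "op_mult I U X i l = X (g i) l" if "l \<in> I" for l
  proof -
    have "op_mult I U X i l = (\<Sum>k\<in>I. if k = g i then X (g i) l else 0)"
      unfolding op_mult_def using assms by (intro sum.cong) auto
    thus ?thesis using assms by simp
  qed
  have "X i j = (\<Sum>l\<in>I. op_mult I U X i l * cnj (U j l))"
    using assms by (simp add: invariant_under_def op_mult_def op_adj_def)
  also have "\<dots> = (\<Sum>l\<in>I. if l = g j then X (g i) (g j) else 0)"
    using assms 1 by (intro sum.cong) auto
  finally show ?thesis using assms by simp
qed

text \<open>\<open>perm_op\<close> gives the row string as a function of the column string.
  Inverting the permutation gives the column as a function of the row, the form required by
  \<open>invariant_under_function\<close>.\<close>

lemma perm_op_eq:
  assumes "\<sigma> permutes {..<n}" "length xs = n" "length ys = n"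
  shows "perm_op \<sigma> xs ys = (if ys = permute_list \<sigma> xs then 1 else 0)"
proof -
  have "permute_list (inv_into UNIV \<sigma>) (permute_list \<sigma> xs) = xs"
    "permute_list \<sigma> (permute_list (inv_into UNIV \<sigma>) ys) = ys"
    using assms permutes_inv[OF assms(1)]
    by (simp_all add: permutes_inv_o flip: permute_list_compose)
  hence "xs = permute_list (inv_into UNIV \<sigma>) ys \<longleftrightarrow> ys = permute_list \<sigma> xs" by metis
  thus ?thesis by (simp add: perm_op_def)
qed

lemma permute_list_strings:
  assumes "\<sigma> permutes {..<n}" "xs \<in> strings I n"
  shows "permute_list \<sigma> xs \<in> strings I n"
  using assms by (auto simp: strings_def)

text \<open>Conjugation permutes row and column string simultaneously and leaves \<open>a\<close>
  and \<open>a'\<close> alone. These may differ, so off-diagonal slices of the state are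
  covered.\<close>

lemma perm_invariant_sndD:
  assumes "finite I" "finite J" "perm_invariant_snd I J n \<rho>" "\<sigma> permutes {..<n}"
    and "a \<in> I" "a' \<in> I" "k \<in> strings J n" "l \<in> strings J n"
  shows "\<rho> (a, permute_list \<sigma> k) (a', permute_list \<sigma> l) = \<rho> (a, k) (a', l)"
proof -
  have "invariant_under (I \<times> strings J n) (op_tensor op_id (perm_op \<sigma>)) \<rho>"
    using assms(3,4) by (simp add: perm_invariant_snd_def)
  hence "\<rho> ((\<lambda>(a, k). (a, permute_list \<sigma> k)) (a, k)) ((\<lambda>(a, k). (a, permute_list \<sigma> k)) (a', l)) =
      \<rho> (a, k) (a', l)"
    by (rule invariant_under_function[rotated])
      (use assms in \<open>auto simp: op_tensor_def op_id_def perm_op_eq permute_list_strings strings_def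
        intro!: finite_cartesian_product finite_lists_length_eq split: if_splits\<close>)
  thus ?thesis by simp
qed

lemma perm_invariant_fstD:
  assumes "finite I" "finite J" "perm_invariant_fst I n J \<rho>" "\<sigma> permutes {..<n}"
    and "b \<in> J" "b' \<in> J" "k \<in> strings I n" "l \<in> strings I n"
  shows "\<rho> (permute_list \<sigma> k, b) (permute_list \<sigma> l, b') = \<rho> (k, b) (l, b')"
proof -
  have "invariant_under (strings I n \<times> J) (op_tensor (perm_op \<sigma>) op_id) \<rho>"
    using assms(3,4) by (simp add: perm_invariant_fst_def)
  hence "\<rho> ((\<lambda>(k, b). (permute_list \<sigma> k, b)) (k, b)) ((\<lambda>(k, b). (permute_list \<sigma> k, b)) (l, b')) =
      \<rho> (k, b) (l, b')"
    by (rule invariant_under_function[rotated])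
      (use assms in \<open>auto simp: op_tensor_def op_id_def perm_op_eq permute_list_strings strings_def
        intro!: finite_cartesian_product finite_lists_length_eq split: if_splits\<close>)
  thus ?thesis by simp
qed

subsection \<open>Chain rules\<close>

text \<open>With the type replaced by the string, the term for \<open>m\<close> is H(A|Z_2..Z_(m+1))
  - H(A|Z_1..Z_(m+1)). Symmetry turns the first entropy into H(A|Z_1..Z_m), and the sum telescopes
  to H(A) - H(A|Z_1..Z_n).\<close>

lemma one_sided_chain_rule:
  assumes fin: "finite I" "finite Z" and n: "n \<ge> 1"
    and diag: "\<And>a a' z z'. a \<in> I \<Longrightarrow> a' \<in> I \<Longrightarrow> z \<in> strings Z n \<Longrightarrow> z' \<in> strings Z n \<Longrightarrow>
      z \<noteq> z' \<Longrightarrow> \<omega> (a, z) (a', z') = 0"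
    and sym: "\<And>a a'. a \<in> I \<Longrightarrow> a' \<in> I \<Longrightarrow> symmetric_on Z n (\<lambda>z. \<omega> (a, z) (a', z))"
    and tr: "op_trace (I \<times> strings Z n) \<omega> = 1"
  shows "mutual_info I (strings Z n) \<omega> =
    (\<Sum>m = 0..n - 1. cond_mutual_info I Z (types Z m) (one_sided_type_state I Z n m \<omega>))"
proof -
  \<comment> \<open>\<open>B m v\<close> is the unnormalized state of A given that the first
    \<open>m\<close> outcomes are \<open>v\<close>. Then \<open>F m\<close> is the conditional
    entropy of A given these outcomes: block entropies minus the entropy of the classical
    register.\<close>
  define B where "B = (\<lambda>m v a a'. marginal Z n (\<lambda>x. \<omega> (a, x) (a', x)) m v)"
  define F where "F = (\<lambda>m. \<Sum>v\<in>strings Z m. vn_entropy I (B m v) - xlog (Re (op_trace I (B m v))))"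
  have step: "cond_mutual_info I Z (types Z m) (one_sided_type_state I Z n m \<omega>) = F m - F (Suc m)"
    if m: "m < n" for m
  proof -
    \<comment> \<open>Here \<open>v\<close> stands for outcomes 2 to m+1 and \<open>z\<close> for
      the first outcome; \<open>W v\<close> is the joint block of A and the first outcome.\<close>
    define W where "W = (\<lambda>v (a, z) (a', z'). if z = z' then B (Suc m) (z # v) a a' else 0)"
    let ?S = "strings Z m"
    have B_Cons: "(\<Sum>z\<in>Z. B (Suc m) (z # v) a a') = B m v a a'" if "v \<in> ?S" "a \<in> I" "a' \<in> I" for v a a'
      unfolding B_def using sum_marginal_Cons[OF sym m] that by blast
    have const: "W v p q = W v' p q"
      if "v \<in> ?S" "v' \<in> ?S" "type_of_string v = type_of_string v'" "p \<in> I \<times> Z" "q \<in> I \<times> Z" for v v' p q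
    proof -
      have "B (Suc m) (z # v) a a' = B (Suc m) (z # v') a a'" if "z \<in> Z" "a \<in> I" "a' \<in> I" for z a a'
        unfolding B_def
        by (rule marginal_symmetric[OF sym]) (use that \<open>v \<in> ?S\<close> \<open>v' \<in> ?S\<close> m
            \<open>type_of_string v = type_of_string v'\<close> in \<open>auto simp: strings_def type_of_string_eq_iff\<close>)
      thus ?thesis using that(4,5) by (auto simp: W_def)
    qed
    have R: "one_sided_type_state I Z n m \<omega> (a, z, t) (a', z', t') =
        (if t = t' then \<Sum>v | v \<in> ?S \<and> type_of_string v = t. W v (a, z) (a', z') else 0)"
      if "a \<in> I" "a' \<in> I" "z \<in> Z" for a a' z z' t t'
      unfolding one_sided_type_state_eq[OF fin that m] W_def B_def by auto
    have "cond_mutual_info I Z (types Z m) (one_sided_type_state I Z n m \<omega>) =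
      (\<Sum>v\<in>?S. vn_entropy I (ptrace_snd Z (W v)) + vn_entropy Z (ptrace_fst I (W v))
        - vn_entropy (I \<times> Z) (W v) - xlog (Re (op_trace (I \<times> Z) (W v))))"
      unfolding types_def
      by (rule cond_mutual_info_type_register[OF fin finite_strings[OF fin(2)] const R])
    also have "\<dots> = (\<Sum>v\<in>?S. (vn_entropy I (B m v) - xlog (Re (op_trace I (B m v)))) -
        (\<Sum>z\<in>Z. vn_entropy I (B (Suc m) (z # v)) - xlog (Re (op_trace I (B (Suc m) (z # v))))))"
    proof (rule sum.cong[OF refl])
      fix v assume v: "v \<in> ?S"
      \<comment> \<open>Summing out the first outcome leaves \<open>m\<close> outcomes, which
        \<open>B_Cons\<close> moves to positions 1 to m.\<close>
      have A: "ptrace_snd Z (W v) a a' = B m v a a'" if "a \<in> I" "a' \<in> I" for a a'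
        using B_Cons[OF v that] by (simp add: ptrace_snd_def W_def)
      have 1: "vn_entropy I (ptrace_snd Z (W v)) = vn_entropy I (B m v)"
        using fin A by (intro vn_entropy_cong) auto
      have 2: "op_trace (I \<times> Z) (W v) = op_trace I (B m v)"
        unfolding op_trace_ptrace_snd[symmetric] using A by (simp add: op_trace_def)
      have 3: "vn_entropy (I \<times> Z) (W v) = (\<Sum>z\<in>Z. vn_entropy I (B (Suc m) (z # v)))"
        using fin by (intro vn_entropy_blocks) (auto simp: W_def)
      have 4: "vn_entropy Z (ptrace_fst I (W v)) = (\<Sum>z\<in>Z. xlog (Re (op_trace I (B (Suc m) (z # v)))))"
        using fin by (subst vn_entropy_diag) (auto simp: ptrace_fst_def W_def op_trace_def)
      show "vn_entropy I (ptrace_snd Z (W v)) + vn_entropy Z (ptrace_fst I (W v))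
          - vn_entropy (I \<times> Z) (W v) - xlog (Re (op_trace (I \<times> Z) (W v))) =
        (vn_entropy I (B m v) - xlog (Re (op_trace I (B m v)))) -
        (\<Sum>z\<in>Z. vn_entropy I (B (Suc m) (z # v)) - xlog (Re (op_trace I (B (Suc m) (z # v)))))"
        unfolding 1 2 3 4 by (simp add: sum_subtractf)
    qed
    \<comment> \<open>A first symbol and a string of length \<open>m\<close> form a string of length
      m+1, so the inner sum contributes \<open>F (Suc m)\<close>.\<close>
    also have "\<dots> = F m - F (Suc m)"
      unfolding F_def sum_strings_Suc 
      by (subst sum.swap[where A = Z and B = ?S]) (simp add: sum_subtractf)
    finally show ?thesis .
  qed
  \<comment> \<open>Subtraction is truncated, so \<open>n \<ge> 1\<close> is what makes the range
    \<open>{0..n - 1}\<close> equal to \<open>{..<n}\<close>.\<close>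
  have "(\<Sum>m = 0..n - 1. cond_mutual_info I Z (types Z m) (one_sided_type_state I Z n m \<omega>)) =
      (\<Sum>m<n. F m - F (Suc m))"
    using n step by (intro sum.cong) auto
  also have "\<dots> = F 0 - F n"
    by (rule sum_lessThan_telescope')
  \<comment> \<open>With no outcome kept, the subtracted \<open>xlog\<close> of the trace vanishes
    because the trace is 1.\<close>
  also have "F 0 = vn_entropy I (ptrace_snd (strings Z n) \<omega>)"
  proof -
    have "B 0 [] = ptrace_snd (strings Z n) \<omega>"
      by (simp add: B_def ptrace_snd_def fun_eq_iff)
    thus ?thesis using tr by (simp add: F_def op_trace_ptrace_snd xlog_def)
  qed
  also have "F n = vn_entropy (I \<times> strings Z n) \<omega> - vn_entropy (strings Z n) (ptrace_fst I \<omega>)"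
  proof -
    have "vn_entropy (I \<times> strings Z n) \<omega> = (\<Sum>v\<in>strings Z n. vn_entropy I (B n v))"
      using fin diag by (intro vn_entropy_blocks) (auto simp: B_def)
    moreover have "vn_entropy (strings Z n) (ptrace_fst I \<omega>) =
        (\<Sum>v\<in>strings Z n. xlog (Re (op_trace I (B n v))))"
      using fin diag by (subst vn_entropy_diag) (auto simp: ptrace_fst_def B_def op_trace_def)
    ultimately show ?thesis by (simp add: F_def sum_subtractf)
  qed
  finally show ?thesis by (simp add: mutual_info_def)
qed

text \<open>With \<open>E a b\<close> the entropy of the first \<open>a\<close> outcomes on one side
  and the first \<open>b\<close> on the other, each summand is minus the mixed second difference of
  \<open>E\<close>. Summing in both directions leaves the four corners.\<close>

lemma two_sided_chain_rule:
  assumes fin: "finite Y" "finite Z" and n: "n \<ge> 1"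
    and diag: "\<And>y z y' z'. y \<in> strings Y n \<Longrightarrow> y' \<in> strings Y n \<Longrightarrow> z \<in> strings Z n \<Longrightarrow> z' \<in> strings Z n \<Longrightarrow>
      (y, z) \<noteq> (y', z') \<Longrightarrow> \<omega> (y, z) (y', z') = 0"
    and symY: "\<And>z. z \<in> strings Z n \<Longrightarrow> symmetric_on Y n (\<lambda>y. \<omega> (y, z) (y, z))"
    and symZ: "\<And>y. y \<in> strings Y n \<Longrightarrow> symmetric_on Z n (\<lambda>z. \<omega> (y, z) (y, z))"
    and tr: "op_trace (strings Y n \<times> strings Z n) \<omega> = 1"
  shows "mutual_info (strings Y n) (strings Z n) \<omega> =
    (\<Sum>a = 0..n - 1. \<Sum>b = 0..n - 1.
      cond_mutual_info Y Z (types Y a \<times> types Z b) (double_type_state Y Z n a b \<omega>))"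
proof -
  define P where "P = (\<lambda>a b y z. marginal Y n (\<lambda>u. marginal Z n (\<lambda>w. \<omega> (u, w) (u, w)) b z) a y)"
  define E where "E = (\<lambda>a b. \<Sum>y\<in>strings Y a. \<Sum>z\<in>strings Z b. xlog (Re (P a b y z)))"
  have sY: "symmetric_on Y n (\<lambda>u. marginal Z n (\<lambda>w. \<omega> (u, w) (u, w)) b z)"
    if "b \<le> n" "z \<in> strings Z b" for b z
    using symmetric_on_marginal[of Z n Y n "\<lambda>u w. \<omega> (u, w) (u, w)"] symY that by blast
  have sZ: "symmetric_on Z n (\<lambda>w. marginal Y n (\<lambda>u. \<omega> (u, w) (u, w)) a y)"
    if "a \<le> n" "y \<in> strings Y a" for a y
    using symmetric_on_marginal[of Y n Z n "\<lambda>w u. \<omega> (u, w) (u, w)"] symZ that by blast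
  \<comment> \<open>Either register can be taken as the outer one, so that the facts about a single
    register apply to both.\<close>
  have P': "P a b y z = marginal Z n (\<lambda>w. marginal Y n (\<lambda>u. \<omega> (u, w) (u, w)) a y) b z" for a b y z
    unfolding P_def by (rule marginal_swap)
  have PY: "(\<Sum>y\<in>Y. P (Suc a) b (y # ys) zs) = P a b ys zs"
    if "a < n" "b \<le> n" "ys \<in> strings Y a" "zs \<in> strings Z b" for a b ys zs
    unfolding P_def using that by (intro sum_marginal_Cons sY)
  have PZ: "(\<Sum>z\<in>Z. P a (Suc b) ys (z # zs)) = P a b ys zs"
    if "a \<le> n" "b < n" "ys \<in> strings Y a" "zs \<in> strings Z b" for a b ys zs
    unfolding P' using that by (intro sum_marginal_Cons sZ)
  have Psym: "P a b y z = P a b y' z'"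
    if "a \<le> n" "b \<le> n" "y \<in> strings Y a" "y' \<in> strings Y a" "z \<in> strings Z b" "z' \<in> strings Z b"
      "mset y = mset y'" "mset z = mset z'" for a b y z y' z'
  proof -
    have "P a b y z = P a b y' z" unfolding P_def using that by (intro marginal_symmetric[OF sY])
    also have "\<dots> = P a b y' z'" unfolding P' using that by (intro marginal_symmetric[OF sZ])
    finally show ?thesis .
  qed
  have Cons: "x # xs \<in> strings X (Suc k) \<longleftrightarrow> x \<in> X \<and> xs \<in> strings X k" for x xs k and X :: "'c set"
    by (auto simp: strings_def)
  have step: "cond_mutual_info Y Z (types Y a \<times> types Z b) (double_type_state Y Z n a b \<omega>) =
      (E (Suc a) b - E (Suc a) (Suc b)) - (E a b - E a (Suc b))"
    if a: "a < n" and b: "b < n" for a b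
  proof -
    \<comment> \<open>\<open>v\<close> is the pair of strings behind the first outcomes
      \<open>y\<close> and \<open>z\<close>. Both sides are measured, so \<open>W v\<close> is
      diagonal and its entropies are sums of \<open>xlog\<close>.\<close>
    define W where "W = (\<lambda>v (y, z) (y', z').
      if y = y' \<and> z = z' then P (Suc a) (Suc b) (y # fst v) (z # snd v) else 0)"
    let ?V = "strings Y a \<times> strings Z b" and ?g = "map_prod type_of_string type_of_string"
    have types: "types Y a \<times> types Z b = ?g ` ?V"
      by (auto simp: types_def)
    have finV: "finite ?V" using fin by simp
    have Vsum: "sum F ?V = (\<Sum>ys\<in>strings Y a. \<Sum>zs\<in>strings Z b. F (ys, zs))" for F :: "_ \<Rightarrow> real"
      by (simp add: sum.cartesian_product)
    have const: "W v p q = W v' p q"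
      if "v \<in> ?V" "v' \<in> ?V" "?g v = ?g v'" "p \<in> Y \<times> Z" "q \<in> Y \<times> Z" for v v' p q
      using that a b by (auto simp: W_def Cons type_of_string_eq_iff intro!: Psym)
    have R: "double_type_state Y Z n a b \<omega> (y, z, k) (y', z', k') =
        (if k = k' then \<Sum>v | v \<in> ?V \<and> ?g v = k. W v (y, z) (y', z') else 0)"
      if "y \<in> Y" "y' \<in> Y" "z \<in> Z" "z' \<in> Z" for y y' z z' k k'
      using double_type_state_eq[OF fin that(1,3) a b, of \<omega> "fst k" "snd k" y' z' "fst k'" "snd k'"]
      by (auto simp: W_def P_def prod_eq_iff)
    have "cond_mutual_info Y Z (types Y a \<times> types Z b) (double_type_state Y Z n a b \<omega>) =
      (\<Sum>v\<in>?V. vn_entropy Y (ptrace_snd Z (W v)) + vn_entropy Z (ptrace_fst Y (W v))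
        - vn_entropy (Y \<times> Z) (W v) - xlog (Re (op_trace (Y \<times> Z) (W v))))"
      unfolding types
      by (rule cond_mutual_info_type_register[OF fin finV const R])
    also have "\<dots> = (\<Sum>v\<in>?V. (\<Sum>y\<in>Y. xlog (Re (P (Suc a) b (y # fst v) (snd v))))
        + (\<Sum>z\<in>Z. xlog (Re (P a (Suc b) (fst v) (z # snd v))))
        - (\<Sum>y\<in>Y. \<Sum>z\<in>Z. xlog (Re (P (Suc a) (Suc b) (y # fst v) (z # snd v))))
        - xlog (Re (P a b (fst v) (snd v))))"
    proof (rule sum.cong[OF refl])
      fix v assume v: "v \<in> ?V"
      \<comment> \<open>Summing out the first outcome \<open>z\<close> shifts \<open>snd v\<close>
        to the first \<open>b\<close> positions; \<open>B\<close> does the same for \<open>y\<close>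
        and \<open>fst v\<close>.\<close>
      have A: "ptrace_snd Z (W v) y y' = (if y = y' then P (Suc a) b (y # fst v) (snd v) else 0)"
        if "y \<in> Y" for y y'
        using PZ[of "Suc a" b "y # fst v" "snd v"] that v a b
        by (auto simp: ptrace_snd_def W_def Cons)
      have B: "ptrace_fst Y (W v) z z' = (if z = z' then P a (Suc b) (fst v) (z # snd v) else 0)"
        if "z \<in> Z" for z z'
        using PY[of a "Suc b" "fst v" "z # snd v"] that v a b
        by (auto simp: ptrace_fst_def W_def Cons)
      have 1: "vn_entropy Y (ptrace_snd Z (W v)) = (\<Sum>y\<in>Y. xlog (Re (P (Suc a) b (y # fst v) (snd v))))"
        using fin A by (subst vn_entropy_diag) auto
      have 2: "vn_entropy Z (ptrace_fst Y (W v)) = (\<Sum>z\<in>Z. xlog (Re (P a (Suc b) (fst v) (z # snd v))))"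
        using fin B by (subst vn_entropy_diag) auto
      have 3: "vn_entropy (Y \<times> Z) (W v) =
          (\<Sum>y\<in>Y. \<Sum>z\<in>Z. xlog (Re (P (Suc a) (Suc b) (y # fst v) (z # snd v))))"
        using fin by (subst vn_entropy_diag) (auto simp: W_def sum.cartesian_product split: if_splits intro!: sum.cong)
      have 4: "op_trace (Y \<times> Z) (W v) = P a b (fst v) (snd v)"
        unfolding op_trace_ptrace_snd[symmetric] using A v a b PY[of a b "fst v" "snd v"]
        by (auto simp: op_trace_def)
      show "vn_entropy Y (ptrace_snd Z (W v)) + vn_entropy Z (ptrace_fst Y (W v))
          - vn_entropy (Y \<times> Z) (W v) - xlog (Re (op_trace (Y \<times> Z) (W v))) =
        (\<Sum>y\<in>Y. xlog (Re (P (Suc a) b (y # fst v) (snd v))))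
        + (\<Sum>z\<in>Z. xlog (Re (P a (Suc b) (fst v) (z # snd v))))
        - (\<Sum>y\<in>Y. \<Sum>z\<in>Z. xlog (Re (P (Suc a) (Suc b) (y # fst v) (z # snd v))))
        - xlog (Re (P a b (fst v) (snd v)))"
        unfolding 1 2 3 4 ..
    qed
    also have "\<dots> = (\<Sum>ys\<in>strings Y a. \<Sum>zs\<in>strings Z b. \<Sum>y\<in>Y. xlog (Re (P (Suc a) b (y # ys) zs)))
        + (\<Sum>ys\<in>strings Y a. \<Sum>zs\<in>strings Z b. \<Sum>z\<in>Z. xlog (Re (P a (Suc b) ys (z # zs))))
        - (\<Sum>ys\<in>strings Y a. \<Sum>zs\<in>strings Z b. \<Sum>y\<in>Y. \<Sum>z\<in>Z. xlog (Re (P (Suc a) (Suc b) (y # ys) (z # zs))))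
        - E a b"
      by (simp add: Vsum E_def sum.distrib sum_subtractf)
    also have "(\<Sum>ys\<in>strings Y a. \<Sum>zs\<in>strings Z b. \<Sum>y\<in>Y. xlog (Re (P (Suc a) b (y # ys) zs))) = E (Suc a) b"
      unfolding E_def sum_strings_Suc sum.swap[where A = "strings Z b" and B = Y]
        sum.swap[where A = "strings Y a" and B = Y] ..
    also have "(\<Sum>ys\<in>strings Y a. \<Sum>zs\<in>strings Z b. \<Sum>z\<in>Z. xlog (Re (P a (Suc b) ys (z # zs)))) = E a (Suc b)"
      unfolding E_def sum_strings_Suc sum.swap[where A = "strings Z b" and B = Z] ..
    also have "(\<Sum>ys\<in>strings Y a. \<Sum>zs\<in>strings Z b. \<Sum>y\<in>Y. \<Sum>z\<in>Z.
        xlog (Re (P (Suc a) (Suc b) (y # ys) (z # zs)))) = E (Suc a) (Suc b)"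
      unfolding E_def sum_strings_Suc sum.swap[where A = "strings Z b" and B = Y]
        sum.swap[where A = "strings Y a" and B = Y] sum.swap[where A = "strings Z b" and B = Z] ..
    finally show ?thesis by simp
  qed
  have "(\<Sum>a = 0..n - 1. \<Sum>b = 0..n - 1.
      cond_mutual_info Y Z (types Y a \<times> types Z b) (double_type_state Y Z n a b \<omega>)) =
    (\<Sum>a<n. \<Sum>b<n. (E (Suc a) b - E (Suc a) (Suc b)) - (E a b - E a (Suc b)))"
    using n step by (intro sum.cong) auto
  \<comment> \<open>The sum over \<open>b\<close> telescopes for each fixed \<open>a\<close>, and
    then the sum over \<open>a\<close>.\<close>
  also have "\<dots> = (\<Sum>a<n. (E (Suc a) 0 - E (Suc a) n) - (E a 0 - E a n))"
    by (rule sum.cong[OF refl], subst sum_subtractf) (simp only: sum_lessThan_telescope')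
  also have "\<dots> = (E n 0 - E n n) - (E 0 0 - E 0 n)"
    by (rule sum_lessThan_telescope[of "\<lambda>a. E a 0 - E a n"])
  also have "E n 0 = vn_entropy (strings Y n) (ptrace_snd (strings Z n) \<omega>)"
    using fin diag by (subst vn_entropy_diag) (auto simp: E_def P_def ptrace_snd_def)
  also have "E 0 n = vn_entropy (strings Z n) (ptrace_fst (strings Y n) \<omega>)"
    using fin diag by (subst vn_entropy_diag) (auto simp: E_def P_def ptrace_fst_def)
  also have "E n n = vn_entropy (strings Y n \<times> strings Z n) \<omega>"
    using fin diag by (subst vn_entropy_diag) (auto simp: E_def P_def sum.cartesian_product case_prod_unfold)
  \<comment> \<open>The empty strings carry the whole trace, which is 1, and \<open>xlog 1\<close>
    is 0.\<close>
  also have "E 0 0 = 0"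
    using tr by (simp add: E_def P_def op_trace_def sum.cartesian_product case_prod_unfold xlog_def)
  finally show ?thesis by (simp add: mutual_info_def)
qed

section \<open>Measured permutation-invariant states satisfy the hypotheses of the chain
  rules\<close>

theorem proposition4p13:
  fixes M\<^sub>A :: "'y::finite \<Rightarrow> 'a::finite opr"
    and M\<^sub>B :: "'z::finite \<Rightarrow> 'b::finite opr"
    and n :: nat
  assumes "is_povm UNIV UNIV M\<^sub>A"
    and "is_povm UNIV UNIV M\<^sub>B"
    and "n \<ge> 1"
  shows
    "(\<forall>\<rho> \<omega>.
        is_state (strings UNIV n \<times> strings UNIV n) \<rho> \<longrightarrow>
        perm_invariant_fst UNIV n (strings UNIV n) \<rho> \<longrightarrow>
        perm_invariant_snd (strings UNIV n) UNIV n \<rho> \<longrightarrow>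
        \<omega> = chan_tensor (strings UNIV n) (strings UNIV n)
              (chan_power UNIV n (measure_chan UNIV M\<^sub>A))
              (chan_power UNIV n (measure_chan UNIV M\<^sub>B)) \<rho> \<longrightarrow>
        mutual_info (strings UNIV n) (strings UNIV n) \<omega> =
          (\<Sum>m\<^sub>A = 0..n - 1. \<Sum>m\<^sub>B = 0..n - 1.
             cond_mutual_info UNIV UNIV (types UNIV m\<^sub>A \<times> types UNIV m\<^sub>B)
               (double_type_state UNIV UNIV n m\<^sub>A m\<^sub>B \<omega>)))
     \<and>
     (\<forall>\<rho> \<omega>.
        is_state (UNIV \<times> strings UNIV n) \<rho> \<longrightarrow>
        perm_invariant_snd UNIV UNIV n \<rho> \<longrightarrow>
        \<omega> = chan_tensor (UNIV :: 'a set) (strings UNIV n)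
              (\<lambda>X. X)
              (chan_power UNIV n (measure_chan UNIV M\<^sub>B)) \<rho> \<longrightarrow>
        mutual_info UNIV (strings UNIV n) \<omega> =
          (\<Sum>m\<^sub>B = 0..n - 1.
             cond_mutual_info UNIV UNIV (types UNIV m\<^sub>B)
               (one_sided_type_state UNIV UNIV n m\<^sub>B \<omega>)))"
proof (intro conjI allI impI)
  fix \<rho> :: "('a list \<times> 'b list) opr" and \<omega> :: "('y list \<times> 'z list) opr"
  assume state: "is_state (strings UNIV n \<times> strings UNIV n) \<rho>"
    and inv_fst: "perm_invariant_fst UNIV n (strings UNIV n) \<rho>"
    and inv_snd: "perm_invariant_snd (strings UNIV n) UNIV n \<rho>"
    and \<omega>: "\<omega> = chan_tensor (strings UNIV n) (strings UNIV n)
      (chan_power UNIV n (measure_chan UNIV M\<^sub>A)) (chan_power UNIV n (measure_chan UNIV M\<^sub>B)) \<rho>"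
  \<comment> \<open>\<open>?q z\<close> is the unnormalized operator on the A-systems left by the
    outcome \<open>z\<close> on the B-systems, and \<open>?p\<close> is the joint outcome
    weight.\<close>
  let ?q = "\<lambda>z i j. measured UNIV M\<^sub>B n (\<lambda>k l. \<rho> (i, k) (j, l)) z"
  let ?p = "\<lambda>y z. measured UNIV M\<^sub>A n (?q z) y"
  have eq: "\<omega> (y, z) (y', z') = (if y = y' \<and> z = z' then ?p y z else 0)"
    if "y \<in> strings UNIV n" "y' \<in> strings UNIV n" "z \<in> strings UNIV n" "z' \<in> strings UNIV n" for y z y' z'
    unfolding \<omega> using that by (intro measured_both) (auto simp: strings_def)
  \<comment> \<open>Each entry of \<open>?q z\<close> is a sum over B-labels with the A-labels
    fixed, so invariance over the A-systems passes to \<open>?q z\<close>.\<close>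
  have symY: "symmetric_on UNIV n (\<lambda>y. ?p y z)" for z
  proof (rule measured_symmetric)
    fix \<sigma> and k l :: "'a list"
    assume \<sigma>: "\<sigma> permutes {..<n}" and kl: "k \<in> strings UNIV n" "l \<in> strings UNIV n"
    show "?q z (permute_list \<sigma> k) (permute_list \<sigma> l) = ?q z k l"
      unfolding measured_def
      by (intro sum.cong refl arg_cong2[where f = "(*)"])
        (rule perm_invariant_fstD[OF _ _ inv_fst \<sigma> _ _ kl], auto)
  qed simp
  \<comment> \<open>Every entry of \<open>?q z\<close>, off-diagonal ones included, is symmetric in
    \<open>z\<close>, and \<open>?p\<close> is a linear combination of these entries.\<close>
  have "symmetric_on UNIV n (\<lambda>z. ?q z i j)" if "i \<in> strings UNIV n" "j \<in> strings UNIV n" for i j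
    by (rule measured_symmetric) (use that in \<open>auto intro: perm_invariant_sndD[OF _ _ inv_snd]\<close>)
  hence symZ: "symmetric_on UNIV n (?p y)" for y
    unfolding symmetric_on_def measured_def[of _ M\<^sub>A]
    by (intro ballI impI sum.cong refl arg_cong2[where f = "(*)"]) blast
  \<comment> \<open>Completeness of the first POVM removes the sum over \<open>y\<close>,
    completeness of the second the sum over \<open>z\<close>.\<close>
  have "op_trace (strings UNIV n \<times> strings UNIV n) \<omega> = (\<Sum>y\<in>strings UNIV n. \<Sum>z\<in>strings UNIV n. ?p y z)"
    unfolding op_trace_def sum.cartesian_product by (intro sum.cong) (auto simp: eq)
  also have "\<dots> = (\<Sum>z\<in>strings UNIV n. op_trace (strings UNIV n) (?q z))"
    by (subst sum.swap) (simp add: sum_measured[OF assms(1)])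
  also have "\<dots> = (\<Sum>i\<in>strings UNIV n. op_trace (strings UNIV n) (\<lambda>k l. \<rho> (i, k) (i, l)))"
    unfolding op_trace_def[of _ "?q _"] by (subst sum.swap) (simp add: sum_measured[OF assms(2)])
  also have "\<dots> = op_trace (strings UNIV n \<times> strings UNIV n) \<rho>"
    by (simp add: op_trace_def sum.cartesian_product)
  finally have tr: "op_trace (strings UNIV n \<times> strings UNIV n) \<omega> = 1"
    using state by (simp add: is_state_def)
  show "mutual_info (strings UNIV n) (strings UNIV n) \<omega> =
      (\<Sum>m\<^sub>A = 0..n - 1. \<Sum>m\<^sub>B = 0..n - 1.
         cond_mutual_info UNIV UNIV (types UNIV m\<^sub>A \<times> types UNIV m\<^sub>B)
           (double_type_state UNIV UNIV n m\<^sub>A m\<^sub>B \<omega>))"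
  proof (rule two_sided_chain_rule[OF _ _ assms(3) _ _ _ tr])
    show "symmetric_on UNIV n (\<lambda>y. \<omega> (y, z) (y, z))" if "z \<in> strings UNIV n" for z
      using symY by (rule iffD1[OF symmetric_on_cong, rotated]) (simp add: eq that)
    show "symmetric_on UNIV n (\<lambda>z. \<omega> (y, z) (y, z))" if "y \<in> strings UNIV n" for y
      using symZ by (rule iffD1[OF symmetric_on_cong, rotated]) (simp add: eq that)
  qed (auto simp: eq)
next
  fix \<rho> :: "('a \<times> 'b list) opr" and \<omega> :: "('a \<times> 'z list) opr"
  assume state: "is_state (UNIV \<times> strings UNIV n) \<rho>"
    and inv: "perm_invariant_snd UNIV UNIV n \<rho>"
    and \<omega>: "\<omega> = chan_tensor UNIV (strings UNIV n) (\<lambda>X. X)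
      (chan_power UNIV n (measure_chan UNIV M\<^sub>B)) \<rho>"
  \<comment> \<open>A is not measured, so all its matrix entries are kept: \<open>?w a a'\<close> is
    one of them as a function of the outcome string.\<close>
  let ?w = "\<lambda>a a'. measured UNIV M\<^sub>B n (\<lambda>k l. \<rho> (a, k) (a', l))"
  have eq: "\<omega> (a, z) (a', z') = (if z = z' then ?w a a' z else 0)"
    if "z \<in> strings UNIV n" "z' \<in> strings UNIV n" for a a' z z'
    unfolding \<omega> using that by (intro measured_snd) (auto simp: strings_def)
  have sym: "symmetric_on UNIV n (?w a a')" for a a'
    by (rule measured_symmetric) (auto intro: perm_invariant_sndD[OF _ _ inv])
  have "op_trace (UNIV \<times> strings UNIV n) \<omega> = (\<Sum>a\<in>UNIV. \<Sum>z\<in>strings UNIV n. ?w a a z)"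
    unfolding op_trace_def sum.cartesian_product by (intro sum.cong) (auto simp: eq)
  also have "\<dots> = op_trace (UNIV \<times> strings UNIV n) \<rho>"
    by (simp add: sum_measured[OF assms(2)] op_trace_def sum.cartesian_product)
  finally have tr: "op_trace (UNIV \<times> strings UNIV n) \<omega> = 1"
    using state by (simp add: is_state_def)
  show "mutual_info UNIV (strings UNIV n) \<omega> =
      (\<Sum>m\<^sub>B = 0..n - 1. cond_mutual_info UNIV UNIV (types UNIV m\<^sub>B)
        (one_sided_type_state UNIV UNIV n m\<^sub>B \<omega>))"
  proof (rule one_sided_chain_rule[OF _ _ assms(3) _ _ tr])
    show "symmetric_on UNIV n (\<lambda>z. \<omega> (a, z) (a', z))" for a a'
      using sym by (rule iffD1[OF symmetric_on_cong, rotated]) (simp add: eq)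
  qed (auto simp: eq)
qed

end
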